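(* Let $\mathbb F$ be $\mathbb C$ or $\mathbb R$, let $t\ge 1$, and let $Q$ be the quiver with vertices $1,\dots,t$ and exactly one arrow $\alpha_i$ between $i$ and $i+1$ for each $i=1,\dots,t-1$ (each $\alpha_i$ is directed either $i\to i+1$ or $i\leftarrow i+1$, arbitrarily). Let $L_{pq}$ and $L_{rs}$ ($1\le p\le q\le t$, $1\le r\le s\le t$, $p\le r$) be two of the indecomposable matrix representations of $Q$ over $\mathbb F$ defined in the context, and let $A=L_{pq}\oplus L_{rs}$ (first summand $L_{pq}$, second summand $L_{rs}$). Then a miniversal deformation of $A$ has at most $1$ parameter. Moreover, it has no parameters (and hence coincides with $A$) in all the cases except for the following cases, in which the representations $A$ and their simplest miniversal deformations $\mathcal A(\lambda)$ are as follows (all matrices of $\mathcal A(\lambda)$ that are not specified coincide with the corresponding matrices of $A$, and arrows whose direction is not specified may have either direction): (i) $A=L_{pq}\oplus L_{q+1,s}$ with $p\le q<s$: $\mathcal A(\lambda)$ has the $1\times 1$ matrix $[\lambda]$ on the arrow between $q$ and $q+1$ (of either direction). (ii) $A=L_{pq}\oplus L_{qs}$ with $p<q<s$, in the following two situations: - the arrows are directed $q-1\to q\to q+1$: $\mathcal A(\lambda)$ has $\begin{bmatrix}1\\0\end{bmatrix}$ on $q-1\to q$ and $\begin{bmatrix}\lambda&1\end{bmatrix}$ on $q\to q+1$; - the arrows are directed $q-1\leftarrow q\leftarrow q+1$: $\mathcal A(\lambda)$ has $\begin{bmatrix}1&0\end{bmatrix}$ on $q-1\leftarrow q$ and $\begin{bmatrix}\lambda\\1\end{bmatrix}$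 on $q\leftarrow q+1$. (iii) $A=L_{pq}\oplus L_{rs}$ with $p<r\le s<q$, in the following two situations (the arrows between consecutive vertices of $r,\dots,s$, if any, having any directions): - the arrows are directed $r-1\to r$ and $s\leftarrow s+1$: $\mathcal A(\lambda)$ has $\begin{bmatrix}1\\0\end{bmatrix}$ on $r-1\to r$, $I_2$ on every arrow between consecutive vertices of $r,\dots,s$, and $\begin{bmatrix}1\\\lambda\end{bmatrix}$ on $s\leftarrow s+1$; - the arrows are directed $r-1\leftarrow r$ and $s\to s+1$: $\mathcal A(\lambda)$ has $\begin{bmatrix}1&0\end{bmatrix}$ on $r-1\leftarrow r$, $I_2$ on every arrow between consecutive vertices of $r,\dots,s$, and $\begin{bmatrix}1&\lambda\end{bmatrix}$ on $s\to s+1$.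
   Context: Let $\mathbb F\in\{\mathbb R,\mathbb C\}$ and let $Q$ be a quiver with vertices $1,\dots,t$ and finitely many arrows. A matrix representation $A$ of $Q$ of dimension $\vec n=(n_1,\dots,n_t)\in\{0,1,2,\dots\}^t$ assigns to each arrow $\alpha\colon p\to q$ a matrix $A_\alpha\in\mathbb F^{n_q\times n_p}$. The direct sum is defined by $(A\oplus B)_\alpha=A_\alpha\oplus B_\alpha$ (block diagonal). For each $n\ge 0$ there is exactly one $n\times 0$ matrix $0_{n0}$ and exactly one $0\times n$ matrix $0_{0n}$, regarded as zero matrices; in direct sums, $M\oplus 0_{m0}=\begin{bmatrix}M\\0\end{bmatrix}$ (append $m$ zero rows) and $M\oplus 0_{0n}=\begin{bmatrix}M&0\end{bmatrix}$ (append $n$ zero columns). For the quiver with one arrow $\alpha_i$ between $i$ and $i+1$ ($1\le i\le t-1$) and $1\le i\le j\le t$, $L_{ij}$ is the matrix representation of dimension $(0,\dots,0,1,\dots,1,0,\dots,0)$ with ones exactly at the positions $i,\dots,j$, which assigns $I_1=[1]$ to each arrow between consecutive vertices of $i,\dots,j$ and (empty) zero matrices to all the other arrows. A deformation of a matrix representation $A$ is a matrix representation $\mathcal A(\lambda_1,\dots,\lambda_k)$ whose matrix entries are power series over $\mathbb F$ in the parameters $\lambda_1,\dots,\lambda_k$ convergent in a neighborhood of $\vec 0$, with $\mathcal A(\vec 0)=A$. Two deformations $\mathcal A(\vec\lambda),\mathcal B(\vec\lambda)$ of $A$ are equivalent if there are matrices $\mathcal I_1(\vec\lambda),\dots,\mathcal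 I_t(\vec\lambda)$ of sizes $n_1\times n_1,\dots,n_t\times n_t$, whose entries are power series convergent in a neighborhood of $\vec 0$, with $\mathcal I_p(\vec 0)=I_{n_p}$, such that $\mathcal B_\alpha(\vec\lambda)=\mathcal I_q(\vec\lambda)\mathcal A_\alpha(\vec\lambda)\mathcal I_p(\vec\lambda)^{-1}$ for each arrow $\alpha\colon p\to q$ in a neighborhood of $\vec 0$. A deformation $\mathcal A(\lambda_1,\dots,\lambda_k)$ of $A$ is versal if every deformation $\mathcal B(\mu_1,\dots,\mu_l)$ of $A$ is equivalent to a deformation of the form $\mathcal A(\varphi_1(\vec\mu),\dots,\varphi_k(\vec\mu))$, where the $\varphi_i$ are power series convergent in a neighborhood of $\vec 0$ with $\varphi_i(\vec 0)=0$. A versal deformation with $k$ parameters is miniversal if there is no versal deformation of $A$ with fewer than $k$ parameters. A simplest miniversal deformation of $A$ is a miniversal deformation of the form $A+\sum_{(\alpha,i,j)\in\varGamma}\varepsilon_{\alpha ij}E_{\alpha ij}$, where $\varGamma$ is a set of triples $(\alpha,i,j)$ ($\alpha\colon p\to q$ an arrow, $1\le i\le n_q$, $1\le j\le n_p$), the $\varepsilon_{\alpha ij}$ are independent parameters, and $E_{\alpha ij}$ is the representation of dimension $\vec n$ all of whose matrix entries are $0$ except for the $(i,j)$ entry of the matrix assigned to $\alpha$, which is $1$.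
   Formalization: Case (ii) is extended to L_pq⊕L_rs with p<r≤q<s, arrows r-1,r and q,q+1 both directed right or both left, with I_2 on the overlap; as printed (r=q only) the claim fails, e.g. L_13⊕L_24 on 1→2→3→4 needs a parameter. *)

theory Defs
  imports "HOL-Analysis.Analysis" "Jordan_Normal_Form.Matrix" "Graph_Theory.Digraph"
begin

section \<open>Convergent power series\<close>

text \<open>A vector of \<open>k\<close> parameters is a function \<open>x :: nat \<Rightarrow> 'a\<close> of which only the
  coordinates \<open>x 0, \<dots>, x (k - 1)\<close> matter; a neighbourhood of the zero vector is a polydisc
  in these coordinates. Multi-indices are the functions \<open>m :: nat \<Rightarrow> nat\<close> vanishing outside
  \<open>{..<k}\<close>. For \<open>k = 0\<close> a power series is a constant. In the intended
  generality, \<open>'a :: {real_normed_field,banach}\<close>, the coefficient field is the real or the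
  complex numbers (Gelfand--Mazur).\<close>

definition convergent_power_series ::
  "nat \<Rightarrow> ((nat \<Rightarrow> 'a::real_normed_field) \<Rightarrow> 'a) \<Rightarrow> bool" where
  "convergent_power_series k f \<longleftrightarrow>
     (\<exists>c r. r > 0 \<and>
       (\<forall>x. (\<forall>i<k. norm (x i) < r) \<longrightarrow>
          ((\<lambda>m. c m * (\<Prod>i<k. x i ^ m i)) has_sum f x) {m :: nat \<Rightarrow> nat. \<forall>i\<ge>k. m i = 0}))"

section \<open>Matrix representations of quivers and their deformations\<close>

text \<open>A quiver is a directed multigraph; a matrix representation of dimension \<open>n\<close> is only
  meaningful on the arcs of the quiver. The type \<open>'a mat\<close> has exactly one
  matrix of each of the sizes \<open>n \<times> 0\<close> and \<open>0 \<times> n\<close>. Matrix indices start at \<open>0\<close>.\<close>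

definition matrix_rep ::
  "('v, 'e) pre_digraph \<Rightarrow> ('v \<Rightarrow> nat) \<Rightarrow> ('e \<Rightarrow> 'a mat) \<Rightarrow> bool" where
  "matrix_rep Q n A \<longleftrightarrow> (\<forall>\<alpha>\<in>arcs Q. A \<alpha> \<in> carrier_mat (n (head Q \<alpha>)) (n (tail Q \<alpha>)))"

definition rep_sum :: "('e \<Rightarrow> 'a::zero mat) \<Rightarrow> ('e \<Rightarrow> 'a mat) \<Rightarrow> 'e \<Rightarrow> 'a mat" where
  "rep_sum A B \<alpha> = diag_block_mat [A \<alpha>, B \<alpha>]"

definition deformation ::
  "('v, 'e) pre_digraph \<Rightarrow> ('v \<Rightarrow> nat) \<Rightarrow> nat \<Rightarrow> ('e \<Rightarrow> 'a::real_normed_field mat) \<Rightarrow>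
   ((nat \<Rightarrow> 'a) \<Rightarrow> 'e \<Rightarrow> 'a mat) \<Rightarrow> bool" where
  "deformation Q n k A D \<longleftrightarrow>
     (\<forall>x. matrix_rep Q n (D x)) \<and>
     (\<forall>\<alpha>\<in>arcs Q. \<forall>i<n (head Q \<alpha>). \<forall>j<n (tail Q \<alpha>).
        convergent_power_series k (\<lambda>x. D x \<alpha> $$ (i, j))) \<and>
     (\<forall>\<alpha>\<in>arcs Q. D (\<lambda>_. 0) \<alpha> = A \<alpha>)"

text \<open>The matrix \<open>J\<close> below is the inverse of the matrix at the tail of \<open>\<alpha>\<close>.\<close>

definition equivalent_deformations ::
  "('v, 'e) pre_digraph \<Rightarrow> ('v \<Rightarrow> nat) \<Rightarrow> nat \<Rightarrow>
   ((nat \<Rightarrow> 'a::real_normed_field) \<Rightarrow> 'e \<Rightarrow> 'a mat) \<Rightarrow> ((nat \<Rightarrow> 'a) \<Rightarrow> 'e \<Rightarrow> 'a mat) \<Rightarrow> bool" where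
  "equivalent_deformations Q n k D E \<longleftrightarrow>
     (\<exists>S :: 'v \<Rightarrow> (nat \<Rightarrow> 'a) \<Rightarrow> 'a mat.
        (\<forall>v\<in>verts Q.
           (\<forall>x. S v x \<in> carrier_mat (n v) (n v)) \<and>
           (\<forall>i<n v. \<forall>j<n v. convergent_power_series k (\<lambda>x. S v x $$ (i, j))) \<and>
           S v (\<lambda>_. 0) = 1\<^sub>m (n v)) \<and>
        (\<exists>r>0. \<forall>x. (\<forall>i<k. norm (x i) < r) \<longrightarrow>
           (\<forall>\<alpha>\<in>arcs Q. \<exists>J \<in> carrier_mat (n (tail Q \<alpha>)) (n (tail Q \<alpha>)).
              inverts_mat (S (tail Q \<alpha>) x) J \<and> inverts_mat J (S (tail Q \<alpha>) x) \<and>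
              E x \<alpha> = S (head Q \<alpha>) x * D x \<alpha> * J)))"

definition versal ::
  "('v, 'e) pre_digraph \<Rightarrow> ('v \<Rightarrow> nat) \<Rightarrow> nat \<Rightarrow> ('e \<Rightarrow> 'a::real_normed_field mat) \<Rightarrow>
   ((nat \<Rightarrow> 'a) \<Rightarrow> 'e \<Rightarrow> 'a mat) \<Rightarrow> bool" where
  "versal Q n k A D \<longleftrightarrow> deformation Q n k A D \<and>
     (\<forall>l B. deformation Q n l A B \<longrightarrow>
        (\<exists>\<phi> :: nat \<Rightarrow> (nat \<Rightarrow> 'a) \<Rightarrow> 'a.
           (\<forall>i<k. convergent_power_series l (\<phi> i) \<and> \<phi> i (\<lambda>_. 0) = 0) \<and>
           equivalent_deformations Q n l B (\<lambda>\<mu>. D (\<lambda>i. \<phi> i \<mu>))))"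

definition miniversal ::
  "('v, 'e) pre_digraph \<Rightarrow> ('v \<Rightarrow> nat) \<Rightarrow> nat \<Rightarrow> ('e \<Rightarrow> 'a::real_normed_field mat) \<Rightarrow>
   ((nat \<Rightarrow> 'a) \<Rightarrow> 'e \<Rightarrow> 'a mat) \<Rightarrow> bool" where
  "miniversal Q n k A D \<longleftrightarrow> versal Q n k A D \<and> (\<forall>l D'. versal Q n l A D' \<longrightarrow> k \<le> l)"

definition elementary_rep ::
  "('v, 'e) pre_digraph \<Rightarrow> ('v \<Rightarrow> nat) \<Rightarrow> 'e \<times> nat \<times> nat \<Rightarrow> 'e \<Rightarrow> 'a::zero_neq_one mat" where
  "elementary_rep Q n = (\<lambda>(\<alpha>, i, j) \<beta>. mat (n (head Q \<beta>)) (n (tail Q \<beta>))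
     (\<lambda>ij. if \<beta> = \<alpha> \<and> ij = (i, j) then 1 else 0))"

text \<open>The independent parameters of a simplest miniversal deformation are indexed by the triples
  in \<open>\<Gamma>\<close>; the bijection \<open>e\<close> numbers them \<open>0, \<dots>, k - 1\<close>.\<close>

definition simplest_miniversal ::
  "('v, 'e) pre_digraph \<Rightarrow> ('v \<Rightarrow> nat) \<Rightarrow> nat \<Rightarrow> ('e \<Rightarrow> 'a::real_normed_field mat) \<Rightarrow>
   ((nat \<Rightarrow> 'a) \<Rightarrow> 'e \<Rightarrow> 'a mat) \<Rightarrow> bool" where
  "simplest_miniversal Q n k A D \<longleftrightarrow> miniversal Q n k A D \<and>
     (\<exists>\<Gamma> e. \<Gamma> \<subseteq> {(\<alpha>, i, j). \<alpha> \<in> arcs Q \<and> i < n (head Q \<alpha>) \<and> j < n (tail Q \<alpha>)} \<and>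
        bij_betw e \<Gamma> {..<k} \<and>
        (\<forall>x. \<forall>\<beta>\<in>arcs Q. \<forall>i<n (head Q \<beta>). \<forall>j<n (tail Q \<beta>).
           D x \<beta> $$ (i, j) =
             A \<beta> $$ (i, j) + (\<Sum>\<gamma>\<in>\<Gamma>. x (e \<gamma>) * elementary_rep Q n \<gamma> \<beta> $$ (i, j))))"

section \<open>Chains and their indecomposable representations\<close>

text \<open>The arrow \<open>i\<close> joins the vertices \<open>i\<close> and \<open>i + 1\<close>; it is directed
  \<open>i \<rightarrow> i + 1\<close> if \<open>fwd i\<close>, and \<open>i \<leftarrow> i + 1\<close> otherwise.\<close>

definition chain_quiver :: "nat \<Rightarrow> (nat \<Rightarrow> bool) \<Rightarrow> (nat, nat) pre_digraph" where
  "chain_quiver t fwd =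
     \<lparr>verts = {1..t}, arcs = {1..<t},
      tail = (\<lambda>i. if fwd i then i else i + 1),
      head = (\<lambda>i. if fwd i then i + 1 else i)\<rparr>"

definition L_dim :: "nat \<Rightarrow> nat \<Rightarrow> nat \<Rightarrow> nat" where
  "L_dim i j v = (if v \<in> {i..j} then 1 else 0)"

definition L_rep ::
  "(nat, 'e) pre_digraph \<Rightarrow> nat \<Rightarrow> nat \<Rightarrow> 'e \<Rightarrow> 'a::zero_neq_one mat" where
  "L_rep Q i j \<alpha> =
     (if head Q \<alpha> \<in> {i..j} \<and> tail Q \<alpha> \<in> {i..j} then 1\<^sub>m 1
      else 0\<^sub>m (L_dim i j (head Q \<alpha>)) (L_dim i j (tail Q \<alpha>)))"

section \<open>The exceptional pairs \<open>L_rep p q\<close>, \<open>L_rep r s\<close> with \<open>p \<le> r\<close>\<close>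

definition adjacent_pair :: "nat \<Rightarrow> nat \<Rightarrow> nat \<Rightarrow> nat \<Rightarrow> bool" where
  "adjacent_pair p q r s \<longleftrightarrow> p \<le> q \<and> r = q + 1 \<and> q < s"

text \<open>The intervals \<open>{p..q}\<close> and \<open>{r..s}\<close> overlap properly, and both arrows at the ends of
  the overlap \<open>{r..q}\<close> point to the right (left). The overlap may have more
  than one vertex: with the overlap restricted to one vertex (\<open>r = q\<close>), the list of
  exceptions would be incomplete. For \<open>1 \<rightarrow> 2 \<rightarrow> 3 \<rightarrow> 4\<close>, \<open>{1..3}\<close> and \<open>{2..4}\<close>, the product of
  the three matrices is \<open>0\<close>, but it is not \<open>0\<close> in the deformation with \<open>[\<lambda> 1]\<close> on \<open>3 \<rightarrow> 4\<close>.\<close>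

definition overlap_right :: "(nat \<Rightarrow> bool) \<Rightarrow> nat \<Rightarrow> nat \<Rightarrow> nat \<Rightarrow> nat \<Rightarrow> bool" where
  "overlap_right fwd p q r s \<longleftrightarrow> p < r \<and> r \<le> q \<and> q < s \<and> fwd (r - 1) \<and> fwd q"

definition overlap_left :: "(nat \<Rightarrow> bool) \<Rightarrow> nat \<Rightarrow> nat \<Rightarrow> nat \<Rightarrow> nat \<Rightarrow> bool" where
  "overlap_left fwd p q r s \<longleftrightarrow> p < r \<and> r \<le> q \<and> q < s \<and> \<not> fwd (r - 1) \<and> \<not> fwd q"

definition nested_inward :: "(nat \<Rightarrow> bool) \<Rightarrow> nat \<Rightarrow> nat \<Rightarrow> nat \<Rightarrow> nat \<Rightarrow> bool" where
  "nested_inward fwd p q r s \<longleftrightarrow> p < r \<and> r \<le> s \<and> s < q \<and> fwd (r - 1) \<and> \<not> fwd s"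

definition nested_outward :: "(nat \<Rightarrow> bool) \<Rightarrow> nat \<Rightarrow> nat \<Rightarrow> nat \<Rightarrow> nat \<Rightarrow> bool" where
  "nested_outward fwd p q r s \<longleftrightarrow> p < r \<and> r \<le> s \<and> s < q \<and> \<not> fwd (r - 1) \<and> fwd s"

end

theory Submission
  imports Defs "Jordan_Normal_Form.Determinant"
begin

text \<open>The proof computes with bases instead of tangent spaces. A deformation of
  \<open>A = L\<^sub>p\<^sub>q \<oplus> L\<^sub>r\<^sub>s\<close> is normalized by an explicit change of basis at each vertex, and each
  change consists of convergent power series because these form a ring in which every series with
  nonzero constant term is invertible (\<open>cps_inverse\<close>; for matrices \<open>near_identity_inverse\<close>). Near the
  origin, equivalence means intertwining by such changes of basis (\<open>intertwines\<close>).

  On a chain, bases can be chosen vertex by vertex from left to right, so every arrow on which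
  \<open>A\<close> has an identity matrix gets the identity matrix again (\<open>chain_straightening\<close>). What remains are
  the arrows where one of the two intervals begins or ends. If the intervals are disjoint, such an
  arrow has a matrix without entries, except the \<open>1 \<times> 1\<close> matrix between adjacent intervals, which is
  \<open>[0]\<close> in \<open>A\<close> and is the parameter \<open>\<lambda>\<close> (\<open>reduce_disjoint\<close>). If they overlap, the remaining changes of
  basis are one \<open>2 \<times> 2\<close> matrix \<open>G\<close> on the whole overlap and one scalar on each side, and they act on a
  vector at the left end and a vector at the right end of the overlap. Each is a column or a row
  according to the direction of its arrow. \<open>G\<close> can bring both vectors into their undeformed form
  unless that form is degenerate: a row and a column with product \<open>0\<close>, or two proportional columns,
  or two proportional rows. In these cases exactly one entry survives (\<open>plane_normal_form\<close>), and they
  are the four exceptional situations \<open>overlap_right\<close>, \<open>overlap_left\<close>, \<open>nested_inward\<close> and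
  \<open>nested_outward\<close>. If an interval ends where the other one ends too, there is no vector on that side,
  and \<open>G\<close> has enough freedom.

  The surviving parameter is necessary: a nonzero \<open>\<lambda>\<close> destroys the degeneracy, and this is preserved
  by every change of basis (\<open>plane_parameter_invariant\<close>). So the one-parameter family is not equivalent to
  the constant one, whereas a deformation without parameters is constant (\<open>simplest_miniversal_1\<close>).\<close>

section \<open>The algebra of convergent power series\<close>

definition multi_indices :: "nat \<Rightarrow> (nat \<Rightarrow> nat) set" where
  "multi_indices k = {m. \<forall>i\<ge>k. m i = 0}"

definition total_degree :: "nat \<Rightarrow> (nat \<Rightarrow> nat) \<Rightarrow> nat" where
  "total_degree k m = (\<Sum>i<k. m i)"

definition monomial :: "nat \<Rightarrow> (nat \<Rightarrow> 'a::comm_monoid_mult) \<Rightarrow> (nat \<Rightarrow> nat) \<Rightarrow> 'a" where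
  "monomial k x m = (\<Prod>i<k. x i ^ m i)"

text \<open>Unconditional convergence on an open polydisc is awkward to multiply. The working notion is
  membership of the weighted \<open>\<ell>\<^sup>1\<close> ball of radius \<open>K\<close> over the closed polydisc of radius \<open>\<rho>\<close>:
  these balls add and multiply like the norm of a Banach algebra, and a smaller polydisc makes the
  norm of a series without constant term arbitrarily small.\<close>

definition majorized ::
  "nat \<Rightarrow> real \<Rightarrow> real \<Rightarrow> ((nat \<Rightarrow> 'a::real_normed_field) \<Rightarrow> 'a) \<Rightarrow> bool" where
  "majorized k \<rho> K f \<longleftrightarrow> (\<exists>c T.
     ((\<lambda>m. norm (c m) * \<rho> ^ total_degree k m) has_sum T) (multi_indices k) \<and> T \<le> K \<and>
     (\<forall>x. (\<forall>i<k. norm (x i) \<le> \<rho>) \<longrightarrow>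
        ((\<lambda>m. c m * monomial k x m) has_sum f x) (multi_indices k)))"

lemma monomial_add: "monomial k x (\<lambda>i. m i + m' i) = monomial k x m * monomial k x m'"
  by (simp add: monomial_def power_add prod.distrib)

lemma total_degree_add: "total_degree k (\<lambda>i. m i + m' i) = total_degree k m + total_degree k m'"
  by (simp add: total_degree_def sum.distrib)

lemma norm_monomial_le:
  fixes x :: "nat \<Rightarrow> 'a::real_normed_field"
  assumes "\<forall>i<k. norm (x i) \<le> \<rho>"
  shows "norm (monomial k x m) \<le> \<rho> ^ total_degree k m"
proof -
  have "norm (monomial k x m) = (\<Prod>i<k. norm (x i) ^ m i)"
    by (simp add: monomial_def norm_power flip: prod_norm)
  also have "\<dots> \<le> (\<Prod>i<k. \<rho> ^ m i)"
    using assms by (intro prod_mono) (auto intro: power_mono)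
  also have "\<dots> = \<rho> ^ total_degree k m"
    by (simp add: total_degree_def power_sum)
  finally show ?thesis .
qed

lemma monomial_const: "monomial k (\<lambda>_. a) m = a ^ total_degree k m"
  by (simp add: monomial_def total_degree_def power_sum)

lemma total_degree_eq_0:
  "m \<in> multi_indices k \<Longrightarrow> total_degree k m = 0 \<longleftrightarrow> m = (\<lambda>_. 0)"
  by (auto simp: multi_indices_def total_degree_def fun_eq_iff) (meson lessThan_iff not_le)

lemma zero_in_multi_indices: "(\<lambda>_. 0) \<in> multi_indices k"
  by (simp add: multi_indices_def)

text \<open>The sum of \<open>\<theta> ^ total_degree k m\<close> is the product of \<open>k\<close> geometric series; an infinite sum
  that does not exist has the value \<open>0\<close>, so the product formula also gives summability.\<close>

lemma summable_geometric_multi_indices: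
  fixes \<theta> :: real
  assumes "0 \<le> \<theta>" "\<theta> < 1"
  shows "(\<lambda>m. \<theta> ^ total_degree k m) summable_on multi_indices k"
proof -
  have geo: "((\<lambda>n. \<theta> ^ n) has_sum (1 / (1 - \<theta>))) UNIV"
    using assms by (intro sums_nonneg_imp_has_sum geometric_sums) auto
  have "infsum (\<lambda>g. \<Prod>i\<in>{..<k}. \<theta> ^ g i) (PiE {..<k} (\<lambda>_. UNIV))
      = (\<Prod>i\<in>{..<k}. infsum (\<lambda>n. \<theta> ^ n) UNIV)"
    using geo assms
    by (intro infsum_prod_PiE_abs) (auto simp: has_sum_imp_summable norm_power)
  also have "\<dots> = (1 / (1 - \<theta>)) ^ k"
    using geo by (simp add: infsumI)
  also have "\<dots> \<noteq> 0"
    using assms by simp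
  finally have s: "(\<lambda>g. \<Prod>i\<in>{..<k}. \<theta> ^ g i) summable_on (PiE {..<k} (\<lambda>_. UNIV))"
    using infsum_not_exists by blast
  have "(\<lambda>m. \<theta> ^ total_degree k m) summable_on multi_indices k
      \<longleftrightarrow> (\<lambda>g. \<Prod>i\<in>{..<k}. \<theta> ^ g i) summable_on (PiE {..<k} (\<lambda>_. UNIV))"
    by (rule summable_on_reindex_bij_witness
        [where i = "\<lambda>g i. if i < k then g i else 0" and j = "\<lambda>m. restrict m {..<k}"])
      (auto simp: multi_indices_def total_degree_def power_sum fun_eq_iff PiE_def extensional_def)
  with s show ?thesis by simp
qed

lemma abs_summable_monomials:
  fixes a :: "'i \<Rightarrow> 'a::real_normed_field"
  assumes "(\<lambda>i. norm (a i) * \<rho> ^ total_degree k (e i)) summable_on I"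
    and "\<forall>i<k. norm (x i) \<le> \<rho>"
  shows "(\<lambda>i. norm (a i * monomial k x (e i))) summable_on I"
  by (rule summable_on_comparison_test[OF assms(1)])
    (auto simp: norm_mult intro!: mult_left_mono norm_monomial_le assms(2))

lemma has_sum_fibres:
  assumes "\<And>i. i \<in> I \<Longrightarrow> e i \<in> M"
  shows "((\<lambda>(m, i). g i) has_sum S) (Sigma M (\<lambda>m. {i \<in> I. e i = m})) \<longleftrightarrow> (g has_sum S) I"
  by (rule has_sum_reindex_bij_witness[where i = "\<lambda>i. (e i, i)" and j = snd])
    (use assms in auto)

text \<open>Every power series below arises from a family of monomials with repeated exponents: collecting
  the terms with the same exponent does not increase the weighted norm.\<close>

lemma majorized_regroup:
  fixes a :: "'i \<Rightarrow> 'a::{real_normed_field,banach}"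
  assumes \<rho>: "\<rho> > 0" and e: "\<And>i. i \<in> I \<Longrightarrow> e i \<in> multi_indices k"
    and norms: "((\<lambda>i. norm (a i) * \<rho> ^ total_degree k (e i)) has_sum T) I" and "T \<le> K"
    and f: "\<And>x. (\<forall>i<k. norm (x i) \<le> \<rho>) \<Longrightarrow>
      ((\<lambda>i. a i * monomial k x (e i)) has_sum f x) I"
  shows "majorized k \<rho> K f"
proof -
  let ?F = "\<lambda>m. {i \<in> I. e i = m}"
  define c where "c m = infsum a (?F m)" for m
  define N where "N m = infsum (\<lambda>i. norm (a i)) (?F m)" for m
  have fib: "(\<lambda>i. norm (a i)) summable_on ?F m" for m
  proof -
    have "(\<lambda>i. norm (a i) * \<rho> ^ total_degree k (e i)) summable_on ?F m"
      using has_sum_imp_summable[OF norms] by (rule summable_on_subset_banach) auto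
    then have "(\<lambda>i. norm (a i) * \<rho> ^ total_degree k m) summable_on ?F m"
      by (rule summable_on_cong[THEN iffD1, rotated]) auto
    then show ?thesis
      using \<rho> by (subst (asm) summable_on_cmult_left') auto
  qed
  have c: "(a has_sum c m) (?F m)" for m
    unfolding c_def by (rule has_sum_infsum[OF abs_summable_summable[OF fib]])
  have N: "((\<lambda>i. norm (a i)) has_sum N m) (?F m)" for m
    unfolding N_def using fib by (rule has_sum_infsum)
  have cN: "norm (c m) \<le> N m" for m
    using norm_infsum_bound[OF fib] by (simp add: c_def N_def)
  have "((\<lambda>m. N m * \<rho> ^ total_degree k m) has_sum T) (multi_indices k)"
  proof (rule has_sum_SigmaD)
    show "((\<lambda>(m, i). norm (a i) * \<rho> ^ total_degree k (e i)) has_sum T)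
        (Sigma (multi_indices k) ?F)"
      using norms by (simp add: has_sum_fibres e)
    show "((\<lambda>i. case (m, i) of (m, i) \<Rightarrow> norm (a i) * \<rho> ^ total_degree k (e i)) has_sum
        N m * \<rho> ^ total_degree k m) (?F m)" for m
      using has_sum_cmult_left[OF N, of "\<rho> ^ total_degree k m"]
      by (rule has_sum_cong[THEN iffD1, rotated]) auto
  qed
  note NT = this
  have "(\<lambda>m. norm (c m) * \<rho> ^ total_degree k m) summable_on multi_indices k"
    using has_sum_imp_summable[OF NT] \<rho> cN
    by (rule_tac summable_on_comparison_test) (auto intro: mult_right_mono)
  then obtain T' where T': "((\<lambda>m. norm (c m) * \<rho> ^ total_degree k m) has_sum T') (multi_indices k)"
    by (auto simp: summable_on_def)
  have "T' \<le> T"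
    using T' NT by (rule has_sum_mono) (use \<rho> cN in \<open>auto intro: mult_right_mono\<close>)
  moreover have "((\<lambda>m. c m * monomial k x m) has_sum f x) (multi_indices k)"
    if x: "\<forall>i<k. norm (x i) \<le> \<rho>" for x
  proof (rule has_sum_SigmaD)
    show "((\<lambda>(m, i). a i * monomial k x (e i)) has_sum f x) (Sigma (multi_indices k) ?F)"
      using f[OF x] by (simp add: has_sum_fibres e)
    show "((\<lambda>i. case (m, i) of (m, i) \<Rightarrow> a i * monomial k x (e i)) has_sum
        c m * monomial k x m) (?F m)" for m
      using has_sum_cmult_left[OF c, of "monomial k x m"]
      by (rule has_sum_cong[THEN iffD1, rotated]) auto
  qed
  ultimately show ?thesis
    unfolding majorized_def using T' \<open>T \<le> K\<close> by (meson order_trans)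
qed

lemma majorized_const:
  fixes a :: "'a::{real_normed_field,banach}"
  assumes "\<rho> > 0"
  shows "majorized k \<rho> (norm a) (\<lambda>_. a)"
  by (rule majorized_regroup[where I = "{()}" and a = "\<lambda>_. a" and e = "\<lambda>_ _. 0", OF assms])
    (auto simp: total_degree_def monomial_def zero_in_multi_indices intro!: has_sum_finiteI)

lemma majorized_mult:
  fixes f g :: "(nat \<Rightarrow> 'a::{real_normed_field,banach}) \<Rightarrow> 'a"
  assumes \<rho>: "\<rho> > 0" and f: "majorized k \<rho> K f" and g: "majorized k \<rho> L g"
  shows "majorized k \<rho> (K * L) (\<lambda>x. f x * g x)"
proof -
  let ?M = "multi_indices k" and ?w = "\<lambda>m. \<rho> ^ total_degree k m"
  obtain c S where c: "((\<lambda>m. norm (c m) * ?w m) has_sum S) ?M" "S \<le> K"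
      "\<And>x. (\<forall>i<k. norm (x i) \<le> \<rho>) \<Longrightarrow> ((\<lambda>m. c m * monomial k x m) has_sum f x) ?M"
    using f unfolding majorized_def by blast
  obtain d T where d: "((\<lambda>m. norm (d m) * ?w m) has_sum T) ?M" "T \<le> L"
      "\<And>x. (\<forall>i<k. norm (x i) \<le> \<rho>) \<Longrightarrow> ((\<lambda>m. d m * monomial k x m) has_sum g x) ?M"
    using g unfolding majorized_def by blast
  let ?e = "\<lambda>(m, m'). (\<lambda>i. m i + m' i :: nat)" and ?a = "\<lambda>(m, m'). c m * d m'"
  have nonneg: "0 \<le> S" "0 \<le> T"
    using c(1) d(1) \<rho> by (auto elim!: has_sum_nonneg)
  have row: "((\<lambda>m'. norm (?a (m, m')) * ?w (?e (m, m'))) has_sum (norm (c m) * ?w m) * T) ?M" for m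
    using has_sum_cmult_right[OF d(1), of "norm (c m) * ?w m"]
    by (simp add: norm_mult total_degree_add power_add algebra_simps)
  have sums: "((\<lambda>m. (norm (c m) * ?w m) * T) has_sum S * T) ?M"
    by (rule has_sum_cmult_left[OF c(1)])
  have summ: "(\<lambda>p. norm (?a p) * ?w (?e p)) summable_on (?M \<times> ?M)"
    by (rule summable_on_SigmaI[OF row has_sum_imp_summable[OF sums]]) (use \<rho> in auto)
  show ?thesis
  proof (rule majorized_regroup[where I = "?M \<times> ?M" and a = ?a and e = ?e, OF \<rho>])
    show "((\<lambda>p. norm (?a p) * ?w (?e p)) has_sum S * T) (?M \<times> ?M)"
      by (rule has_sum_SigmaI[OF row sums summ])
    show "S * T \<le> K * L"
      using c(2) d(2) nonneg by (intro mult_mono) auto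
    fix x :: "nat \<Rightarrow> 'a" assume x: "\<forall>i<k. norm (x i) \<le> \<rho>"
    show "((\<lambda>p. ?a p * monomial k x (?e p)) has_sum f x * g x) (?M \<times> ?M)"
    proof (rule has_sum_SigmaI)
      show "((\<lambda>m'. ?a (m, m') * monomial k x (?e (m, m'))) has_sum c m * monomial k x m * g x) ?M"
        for m
        using has_sum_cmult_right[OF d(3)[OF x], of "c m * monomial k x m"]
        by (simp add: monomial_add algebra_simps)
      show "((\<lambda>m. c m * monomial k x m * g x) has_sum f x * g x) ?M"
        by (rule has_sum_cmult_left[OF c(3)[OF x]])
      show "(\<lambda>p. ?a p * monomial k x (?e p)) summable_on ?M \<times> ?M"
        by (rule abs_summable_summable, rule abs_summable_monomials[OF summ x])
    qed
  qed (auto simp: multi_indices_def)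
qed

lemma majorized_has_sum:
  fixes f :: "'n \<Rightarrow> (nat \<Rightarrow> 'a::{real_normed_field,banach}) \<Rightarrow> 'a"
  assumes \<rho>: "\<rho> > 0" and f: "\<And>n. n \<in> N \<Longrightarrow> majorized k \<rho> (K n) (f n)"
    and K: "(K has_sum L) N"
    and g: "\<And>x. (\<forall>i<k. norm (x i) \<le> \<rho>) \<Longrightarrow> ((\<lambda>n. f n x) has_sum g x) N"
  shows "majorized k \<rho> L g"
proof -
  let ?M = "multi_indices k" and ?w = "\<lambda>m. \<rho> ^ total_degree k m"
  have "\<forall>n\<in>N. \<exists>c T. ((\<lambda>m. norm (c m) * ?w m) has_sum T) ?M \<and> T \<le> K n \<and>
      (\<forall>x. (\<forall>i<k. norm (x i) \<le> \<rho>) \<longrightarrow> ((\<lambda>m. c m * monomial k x m) has_sum f n x) ?M)"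
    using f unfolding majorized_def by blast
  from bchoice[OF this] obtain c where
    "\<forall>n\<in>N. \<exists>T. ((\<lambda>m. norm (c n m) * ?w m) has_sum T) ?M \<and> T \<le> K n \<and>
      (\<forall>x. (\<forall>i<k. norm (x i) \<le> \<rho>) \<longrightarrow> ((\<lambda>m. c n m * monomial k x m) has_sum f n x) ?M)" ..
  from bchoice[OF this] obtain T where
    cT: "\<forall>n\<in>N. ((\<lambda>m. norm (c n m) * ?w m) has_sum T n) ?M \<and> T n \<le> K n \<and>
      (\<forall>x. (\<forall>i<k. norm (x i) \<le> \<rho>) \<longrightarrow> ((\<lambda>m. c n m * monomial k x m) has_sum f n x) ?M)" ..
  have c: "((\<lambda>m. norm (c n m) * ?w m) has_sum T n) ?M" "T n \<le> K n"
      "\<forall>i<k. norm (x i) \<le> \<rho> \<Longrightarrow> ((\<lambda>m. c n m * monomial k x m) has_sum f n x) ?M"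
    if "n \<in> N" for n x
    using cT that by blast+
  have T0: "0 \<le> T n" if "n \<in> N" for n
    using c(1)[OF that] \<rho> by (auto elim!: has_sum_nonneg)
  have "T summable_on N"
    by (rule summable_on_comparison_test[OF has_sum_imp_summable[OF K]]) (use c(2) T0 in auto)
  then obtain S where S: "(T has_sum S) N" by (auto simp: summable_on_def)
  have summ: "(\<lambda>p. norm (case_prod c p) * ?w (snd p)) summable_on (N \<times> ?M)"
    by (rule summable_on_SigmaI[OF _ has_sum_imp_summable[OF S]]) (use \<rho> c(1) in auto)
  show ?thesis
  proof (rule majorized_regroup[where I = "N \<times> ?M" and a = "case_prod c" and e = snd, OF \<rho>])
    show "((\<lambda>p. norm (case_prod c p) * ?w (snd p)) has_sum S) (N \<times> ?M)"
      by (rule has_sum_SigmaI[OF _ S summ]) (use c(1) in auto)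
    show "S \<le> L"
      using S K c(2) by (rule has_sum_mono)
    fix x :: "nat \<Rightarrow> 'a" assume x: "\<forall>i<k. norm (x i) \<le> \<rho>"
    show "((\<lambda>p. case_prod c p * monomial k x (snd p)) has_sum g x) (N \<times> ?M)"
    proof (rule has_sum_SigmaI)
      show "((\<lambda>m. case_prod c (n, m) * monomial k x (snd (n, m))) has_sum f n x) ?M"
        if "n \<in> N" for n
        using c(3)[OF that x] by simp
      show "((\<lambda>n. f n x) has_sum g x) N" by (rule g[OF x])
      show "(\<lambda>p. case_prod c p * monomial k x (snd p)) summable_on N \<times> ?M"
        by (rule abs_summable_summable, rule abs_summable_monomials[OF summ x])
    qed
  qed auto
qed

lemma majorized_add:
  fixes f g :: "(nat \<Rightarrow> 'a::{real_normed_field,banach}) \<Rightarrow> 'a"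
  assumes "\<rho> > 0" "majorized k \<rho> K f" "majorized k \<rho> L g"
  shows "majorized k \<rho> (K + L) (\<lambda>x. f x + g x)"
  by (rule majorized_has_sum[where N = UNIV and f = "\<lambda>b. if b then f else g"
        and K = "\<lambda>b. if b then K else L"])
    (use assms in \<open>auto simp: UNIV_bool intro!: has_sum_finiteI\<close>)

lemma majorized_power:
  fixes g :: "(nat \<Rightarrow> 'a::{real_normed_field,banach}) \<Rightarrow> 'a"
  assumes "\<rho> > 0" "majorized k \<rho> \<theta> g"
  shows "majorized k \<rho> (\<theta> ^ n) (\<lambda>x. g x ^ n)"
proof (induction n)
  case 0
  show ?case using majorized_const[OF assms(1), of k 1] by simp
next
  case (Suc n)
  show ?case using majorized_mult[OF assms Suc.IH] by simp
qed

lemma majorized_norm_le: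
  assumes "majorized k \<rho> K f" "\<forall>i<k. norm (x i) \<le> \<rho>"
  shows "norm (f x) \<le> K"
proof -
  let ?M = "multi_indices k" and ?w = "\<lambda>m. \<rho> ^ total_degree k m"
  obtain c S where c: "((\<lambda>m. norm (c m) * ?w m) has_sum S) ?M" "S \<le> K"
      "\<And>x. (\<forall>i<k. norm (x i) \<le> \<rho>) \<Longrightarrow> ((\<lambda>m. c m * monomial k x m) has_sum f x) ?M"
    using assms(1) unfolding majorized_def by blast
  have "norm (f x) \<le> S"
    using c(3)[OF assms(2)] c(1)
    by (rule norm_infsum_le) (auto simp: norm_mult intro!: mult_left_mono norm_monomial_le assms)
  with c(2) show ?thesis by simp
qed

text \<open>The only monomial not affected by shrinking the polydisc is the constant one.\<close>

lemma majorized_shrink: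
  assumes "majorized k \<rho> K f" "\<rho> > 0" "0 < \<tau>" "\<tau> \<le> 1"
  shows "majorized k (\<tau> * \<rho>) (if f (\<lambda>_. 0) = 0 then \<tau> * K else K) f"
    (is "majorized _ _ ?K' _")
proof -
  let ?M = "multi_indices k" and ?w = "\<lambda>m. \<rho> ^ total_degree k m"
  obtain c S where c: "((\<lambda>m. norm (c m) * ?w m) has_sum S) ?M" "S \<le> K"
      "\<And>x. (\<forall>i<k. norm (x i) \<le> \<rho>) \<Longrightarrow> ((\<lambda>m. c m * monomial k x m) has_sum f x) ?M"
    using assms(1) unfolding majorized_def by blast
  define \<sigma> where "\<sigma> = (if f (\<lambda>_. 0) = 0 then \<tau> else 1)"
  have "((\<lambda>m. c m * monomial k (\<lambda>_. 0) m) has_sum f (\<lambda>_. 0)) ?M"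
    using assms by (intro c(3)) auto
  moreover have "((\<lambda>m. c m * monomial k (\<lambda>_. 0) m) has_sum c (\<lambda>_. 0)) ?M"
    by (rule has_sum_finite_neutralI[where B = "{\<lambda>_. 0}"])
      (auto simp: monomial_const zero_in_multi_indices total_degree_eq_0, simp add: total_degree_def)
  ultimately have c0: "c (\<lambda>_. 0) = f (\<lambda>_. 0)"
    using has_sum_unique by blast
  have le: "norm (c m) * (\<tau> * \<rho>) ^ total_degree k m \<le> \<sigma> * (norm (c m) * ?w m)" if "m \<in> ?M" for m
  proof (cases "total_degree k m = 0")
    case True
    then have "m = (\<lambda>_. 0)" using that by (simp add: total_degree_eq_0)
    then show ?thesis using c0 by (auto simp: \<sigma>_def total_degree_def)
  next
    case False
    have "\<tau> ^ total_degree k m \<le> \<tau> ^ 1"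
      using assms False by (intro power_decreasing) auto
    also have "\<dots> \<le> \<sigma>" using assms by (simp add: \<sigma>_def)
    finally have "\<tau> ^ total_degree k m * (norm (c m) * ?w m) \<le> \<sigma> * (norm (c m) * ?w m)"
      using assms by (intro mult_right_mono) auto
    then show ?thesis by (simp add: power_mult_distrib algebra_simps)
  qed
  have sums: "((\<lambda>m. \<sigma> * (norm (c m) * ?w m)) has_sum \<sigma> * S) ?M"
    by (rule has_sum_cmult_right[OF c(1)])
  have "(\<lambda>m. norm (c m) * (\<tau> * \<rho>) ^ total_degree k m) summable_on ?M"
    by (rule summable_on_comparison_test[OF has_sum_imp_summable[OF sums]]) (use le assms in auto)
  then obtain T where T: "((\<lambda>m. norm (c m) * (\<tau> * \<rho>) ^ total_degree k m) has_sum T) ?M"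
    by (auto simp: summable_on_def)
  have "T \<le> \<sigma> * S"
    using T sums le by (rule has_sum_mono)
  also have "\<dots> \<le> ?K'"
    using assms c(2) by (auto simp: \<sigma>_def)
  finally have "T \<le> ?K'" .
  moreover have "((\<lambda>m. c m * monomial k x m) has_sum f x) ?M"
    if "\<forall>i<k. norm (x i) \<le> \<tau> * \<rho>" for x
  proof -
    have "\<tau> * \<rho> \<le> \<rho>" using assms by simp
    with that show ?thesis by (intro c(3)) force
  qed
  ultimately show ?thesis unfolding majorized_def using T by blast
qed

lemma has_sum_imp_bounded_terms:
  fixes f :: "'i \<Rightarrow> 'a::real_normed_vector"
  assumes "(f has_sum S) A"
  obtains B where "\<And>a. a \<in> A \<Longrightarrow> norm (f a) \<le> B"
proof -
  have "\<forall>\<^sub>F X in finite_subsets_at_top A. dist (sum f X) S < 1"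
    using assms unfolding has_sum_def by (rule tendstoD) simp
  then obtain F where F: "finite F" "F \<subseteq> A"
    "\<And>X. finite X \<Longrightarrow> F \<subseteq> X \<Longrightarrow> X \<subseteq> A \<Longrightarrow> dist (sum f X) S < 1"
    unfolding eventually_finite_subsets_at_top by metis
  have "norm (f a) \<le> 2 + (\<Sum>b\<in>F. norm (f b))" if "a \<in> A" for a
  proof (cases "a \<in> F")
    case True
    then show ?thesis
      using member_le_sum[of a F "\<lambda>b. norm (f b)"] F(1) by auto
  next
    case False
    have "f a = sum f (insert a F) - sum f F"
      using False F(1) by simp
    also have "norm \<dots> \<le> dist (sum f (insert a F)) S + dist (sum f F) S"
      by (metis dist_norm dist_triangle2)
    also have "\<dots> \<le> 2"
      using F(3)[of "insert a F"] F(3)[of F] F(1,2) that by fastforce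
    finally show ?thesis
      using sum_nonneg[of F "\<lambda>b. norm (f b)"] by simp
  qed
  then show thesis by (rule that)
qed

text \<open>At a point with positive coordinates the terms of a convergent series are bounded, so on a
  smaller polydisc they are dominated by a geometric series.\<close>

lemma convergent_power_series_iff_majorized:
  fixes f :: "(nat \<Rightarrow> 'a::{real_normed_field,banach}) \<Rightarrow> 'a"
  shows "convergent_power_series k f \<longleftrightarrow> (\<exists>\<rho>>0. \<exists>K. majorized k \<rho> K f)"
proof
  assume "convergent_power_series k f"
  then obtain c r where r: "r > 0" and c: "\<And>x. \<forall>i<k. norm (x i) < r \<Longrightarrow>
      ((\<lambda>m. c m * monomial k x m) has_sum f x) (multi_indices k)"
    unfolding convergent_power_series_def monomial_def multi_indices_def by blast
  define \<rho> where "\<rho> = r / 2"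
  have \<rho>: "\<rho> > 0" using r by (simp add: \<rho>_def)
  have "((\<lambda>m. c m * monomial k (\<lambda>_. of_real \<rho>) m) has_sum f (\<lambda>_. of_real \<rho>)) (multi_indices k)"
    using r by (intro c) (simp add: \<rho>_def)
  then obtain B where "\<And>m. m \<in> multi_indices k \<Longrightarrow> norm (c m * monomial k (\<lambda>_. of_real \<rho>) m) \<le> B"
    by (rule has_sum_imp_bounded_terms) blast
  then have B: "norm (c m) * \<rho> ^ total_degree k m \<le> B" if "m \<in> multi_indices k" for m
    using that \<rho> by (force simp: norm_mult monomial_const norm_power)
  have "(\<lambda>m. norm (c m) * (\<rho> / 2) ^ total_degree k m) summable_on multi_indices k"
  proof (rule summable_on_comparison_test)
    show "(\<lambda>m. B * (1 / 2) ^ total_degree k m) summable_on multi_indices k"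
      by (intro summable_on_cmult_right summable_geometric_multi_indices) auto
    fix m assume "m \<in> multi_indices k"
    then have "norm (c m) * \<rho> ^ total_degree k m * (1 / 2) ^ total_degree k m
        \<le> B * (1 / 2) ^ total_degree k m"
      by (intro mult_right_mono B) auto
    then show "norm (c m) * (\<rho> / 2) ^ total_degree k m \<le> B * (1 / 2) ^ total_degree k m"
      by (simp add: power_divide)
  qed (use \<rho> in auto)
  then obtain T where "((\<lambda>m. norm (c m) * (\<rho> / 2) ^ total_degree k m) has_sum T) (multi_indices k)"
    by (auto simp: summable_on_def)
  then have "majorized k (\<rho> / 2) T f"
    unfolding majorized_def using c r by (intro exI[of _ c] exI[of _ T]) (force simp: \<rho>_def)
  then show "\<exists>\<rho>>0. \<exists>K. majorized k \<rho> K f"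
    using \<rho> by (intro exI[of _ "\<rho> / 2"]) auto
next
  assume "\<exists>\<rho>>0. \<exists>K. majorized k \<rho> K f"
  then show "convergent_power_series k f"
    unfolding majorized_def convergent_power_series_def monomial_def multi_indices_def
    by (meson less_imp_le)
qed

lemma majorized_smaller:
  assumes "majorized k \<rho> K f" "0 < \<sigma>" "\<sigma> \<le> \<rho>"
  shows "\<exists>L. majorized k \<sigma> L f"
proof -
  have "majorized k ((\<sigma> / \<rho>) * \<rho>) (if f (\<lambda>_. 0) = 0 then (\<sigma> / \<rho>) * K else K) f"
    using assms by (intro majorized_shrink) auto
  moreover have "(\<sigma> / \<rho>) * \<rho> = \<sigma>"
    using assms by simp
  ultimately show ?thesis by metis
qed

lemma cps_if_majorized:
  fixes f :: "(nat \<Rightarrow> 'a::{real_normed_field,banach}) \<Rightarrow> 'a"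
  assumes "\<rho> > 0" "majorized k \<rho> K f"
  shows "convergent_power_series k f"
  unfolding convergent_power_series_iff_majorized using assms by auto

named_theorems cps_intros

lemma cps_const [cps_intros]:
  "convergent_power_series k (\<lambda>_. a :: 'a::{real_normed_field,banach})"
  by (rule cps_if_majorized[OF _ majorized_const, of 1]) simp_all

lemma cps_coordinate [cps_intros]:
  assumes "j < k"
  shows "convergent_power_series k (\<lambda>x. x j :: 'a::{real_normed_field,banach})"
proof -
  let ?e = "\<lambda>i. if i = j then 1 else 0 :: nat"
  have mon: "monomial k x ?e = x j" for x :: "nat \<Rightarrow> 'a"
    using assms by (simp add: monomial_def if_distrib[of "power _"] prod.delta cong: if_cong)
  have "majorized k 1 1 (\<lambda>x. x j :: 'a)"
    by (rule majorized_regroup[where I = "{()}" and a = "\<lambda>_. 1" and e = "\<lambda>_. ?e" and T = 1])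
      (use assms in \<open>auto simp: mon multi_indices_def intro!: has_sum_finiteI\<close>)
  then show ?thesis
    by (rule cps_if_majorized[rotated]) simp
qed

lemma cps_common_polydisc:
  fixes f g :: "(nat \<Rightarrow> 'a::{real_normed_field,banach}) \<Rightarrow> 'a"
  assumes "convergent_power_series k f" "convergent_power_series k g"
  obtains \<rho> K L where "\<rho> > 0" "majorized k \<rho> K f" "majorized k \<rho> L g"
proof -
  obtain \<rho> \<sigma> K L where "\<rho> > 0" "\<sigma> > 0" "majorized k \<rho> K f" "majorized k \<sigma> L g"
    using assms unfolding convergent_power_series_iff_majorized by blast
  then show thesis
    using majorized_smaller[of k \<rho> K f "min \<rho> \<sigma>"] majorized_smaller[of k \<sigma> L g "min \<rho> \<sigma>"]
      that[of "min \<rho> \<sigma>"] by force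
qed

lemma cps_add [cps_intros]:
  fixes f g :: "(nat \<Rightarrow> 'a::{real_normed_field,banach}) \<Rightarrow> 'a"
  assumes "convergent_power_series k f" "convergent_power_series k g"
  shows "convergent_power_series k (\<lambda>x. f x + g x)"
  by (rule cps_common_polydisc[OF assms]) (rule cps_if_majorized, assumption, rule majorized_add)

lemma cps_mult [cps_intros]:
  fixes f g :: "(nat \<Rightarrow> 'a::{real_normed_field,banach}) \<Rightarrow> 'a"
  assumes "convergent_power_series k f" "convergent_power_series k g"
  shows "convergent_power_series k (\<lambda>x. f x * g x)"
  by (rule cps_common_polydisc[OF assms]) (rule cps_if_majorized, assumption, rule majorized_mult)

lemma cps_uminus [cps_intros]:
  fixes f :: "(nat \<Rightarrow> 'a::{real_normed_field,banach}) \<Rightarrow> 'a"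
  shows "convergent_power_series k f \<Longrightarrow> convergent_power_series k (\<lambda>x. - f x)"
  using cps_mult[OF cps_const, of k f "-1"] by simp

lemma cps_diff [cps_intros]:
  fixes f g :: "(nat \<Rightarrow> 'a::{real_normed_field,banach}) \<Rightarrow> 'a"
  shows "convergent_power_series k f \<Longrightarrow> convergent_power_series k g \<Longrightarrow>
    convergent_power_series k (\<lambda>x. f x - g x)"
  using cps_add[OF _ cps_uminus, of k f g] by simp

lemma cps_sum [cps_intros]:
  fixes f :: "'i \<Rightarrow> (nat \<Rightarrow> 'a::{real_normed_field,banach}) \<Rightarrow> 'a"
  shows "(\<And>i. i \<in> I \<Longrightarrow> convergent_power_series k (f i)) \<Longrightarrow>
    convergent_power_series k (\<lambda>x. \<Sum>i\<in>I. f i x)"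
  by (induction I rule: infinite_finite_induct) (auto intro: cps_intros)

lemma cps_prod [cps_intros]:
  fixes f :: "'i \<Rightarrow> (nat \<Rightarrow> 'a::{real_normed_field,banach}) \<Rightarrow> 'a"
  shows "(\<And>i. i \<in> I \<Longrightarrow> convergent_power_series k (f i)) \<Longrightarrow>
    convergent_power_series k (\<lambda>x. \<Prod>i\<in>I. f i x)"
  by (induction I rule: infinite_finite_induct) (auto intro: cps_intros)

lemma cps_majorized_small:
  fixes f :: "(nat \<Rightarrow> 'a::{real_normed_field,banach}) \<Rightarrow> 'a"
  assumes "convergent_power_series k f" "f (\<lambda>_. 0) = 0" "\<theta> > 0"
  shows "\<exists>\<rho>>0. majorized k \<rho> \<theta> f"
proof -
  obtain \<rho> K where \<rho>: "\<rho> > 0" "majorized k \<rho> K f"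
    using assms convergent_power_series_iff_majorized by blast
  have K: "0 \<le> K"
    using majorized_norm_le[OF \<rho>(2), of "\<lambda>_. 0"] \<rho>(1) assms(2) by simp
  define \<tau> where "\<tau> = \<theta> / (K + \<theta>)"
  have \<tau>: "0 < \<tau>" "\<tau> \<le> 1" "\<tau> * (K + \<theta>) = \<theta>"
    using K assms(3) by (auto simp: \<tau>_def divide_simps)
  have "majorized k (\<tau> * \<rho>) (\<tau> * K) f"
    using majorized_shrink[OF \<rho>(2,1) \<tau>(1,2)] assms(2) by simp
  moreover have "\<tau> * K \<le> \<theta>"
    using \<tau>(1,3) assms(3) by (simp add: distrib_left) (smt (verit) mult_pos_pos)
  ultimately have "majorized k (\<tau> * \<rho>) \<theta> f"
    unfolding majorized_def by (meson order_trans)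
  then show ?thesis using \<tau>(1) \<rho>(1) by (intro exI[of _ "\<tau> * \<rho>"]) simp
qed

text \<open>The geometric series of \<open>1 - f x / f 0\<close>, which has norm at most \<open>1 / 2\<close> on a small polydisc.\<close>

lemma cps_inverse [cps_intros]:
  fixes f :: "(nat \<Rightarrow> 'a::{real_normed_field,banach}) \<Rightarrow> 'a"
  assumes "convergent_power_series k f" "f (\<lambda>_. 0) \<noteq> 0"
  shows "convergent_power_series k (\<lambda>x. inverse (f x))"
proof -
  define g where "g x = 1 - f x * inverse (f (\<lambda>_. 0))" for x
  have "convergent_power_series k g"
    unfolding g_def by (intro cps_intros assms)
  then obtain \<rho> where \<rho>: "\<rho> > 0" and g: "majorized k \<rho> (1 / 2) g"
    using cps_majorized_small[of k g "1 / 2"] assms(2) by (auto simp: g_def)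
  have "majorized k \<rho> 2 (\<lambda>x. inverse (1 - g x))"
  proof (rule majorized_has_sum[OF \<rho>, where N = UNIV])
    show "majorized k \<rho> ((1 / 2) ^ n) (\<lambda>x. g x ^ n)" for n
      by (rule majorized_power[OF \<rho> g])
    show "((\<lambda>n. (1 / 2 :: real) ^ n) has_sum 2) UNIV"
      using geometric_sums[of "1 / 2 :: real"] by (intro sums_nonneg_imp_has_sum) auto
    show "((\<lambda>n. g x ^ n) has_sum inverse (1 - g x)) UNIV" if "\<forall>i<k. norm (x i) \<le> \<rho>" for x
    proof -
      have lt: "norm (g x) < 1"
        using majorized_norm_le[OF g that] by simp
      then have "summable (\<lambda>n. norm (g x ^ n))"
        by (simp add: norm_power summable_geometric)
      moreover have "(\<lambda>n. g x ^ n) sums inverse (1 - g x)"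
        using geometric_sums[OF lt] by (simp add: inverse_eq_divide)
      ultimately show ?thesis by (rule norm_summable_imp_has_sum)
    qed
  qed
  then have "convergent_power_series k (\<lambda>x. inverse (f (\<lambda>_. 0)) * inverse (1 - g x))"
    using \<rho> by (intro cps_intros cps_if_majorized)
  moreover have "inverse (f (\<lambda>_. 0)) * inverse (1 - g x) = inverse (f x)" for x
    using assms(2) by (simp add: g_def)
  ultimately show ?thesis by simp
qed

lemma cps_divide [cps_intros]:
  fixes f g :: "(nat \<Rightarrow> 'a::{real_normed_field,banach}) \<Rightarrow> 'a"
  shows "convergent_power_series k f \<Longrightarrow> convergent_power_series k g \<Longrightarrow> g (\<lambda>_. 0) \<noteq> 0 \<Longrightarrow>
    convergent_power_series k (\<lambda>x. f x / g x)"
  unfolding divide_inverse by (intro cps_intros)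

text \<open>The neighbourhoods of the origin are polydiscs in the first \<open>k\<close> coordinates only; the remaining
  coordinates are arbitrary. As a filter they allow finitely many local conditions to be combined.\<close>

definition near_zero :: "nat \<Rightarrow> (nat \<Rightarrow> 'a::real_normed_field) filter" where
  "near_zero k = (INF r\<in>{0<..}. principal {x. \<forall>i<k. norm (x i) < r})"

lemma eventually_near_zero:
  "eventually P (near_zero k) \<longleftrightarrow> (\<exists>r>0. \<forall>x. (\<forall>i<k. norm (x i) < r) \<longrightarrow> P x)"
proof -
  have "eventually P (near_zero k) \<longleftrightarrow>
      (\<exists>r\<in>{0<..}. eventually P (principal {x. \<forall>i<k. norm (x i) < r}))"
    unfolding near_zero_def
  proof (rule eventually_INF_base)
    show "\<exists>x\<in>{0<..}. principal {y. \<forall>i<k. norm (y i) < x}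
        \<le> inf (principal {x. \<forall>i<k. norm (x i) < a}) (principal {x. \<forall>i<k. norm (x i) < b})"
      if "a \<in> {0<..}" "b \<in> {0<..}" for a b :: real
      by (rule bexI[of _ "min a b"]) (use that in auto)
  qed auto
  then show ?thesis by (auto simp: eventually_principal)
qed

lemma cps_eventually_nonzero:
  fixes f :: "(nat \<Rightarrow> 'a::{real_normed_field,banach}) \<Rightarrow> 'a"
  assumes "convergent_power_series k f" "f (\<lambda>_. 0) \<noteq> 0"
  shows "\<forall>\<^sub>F x in near_zero k. f x \<noteq> 0"
proof -
  let ?g = "\<lambda>x. f x - f (\<lambda>_. 0)" and ?\<epsilon> = "norm (f (\<lambda>_. 0)) / 2"
  have "\<exists>\<rho>>0. majorized k \<rho> ?\<epsilon> ?g"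
    using assms by (intro cps_majorized_small cps_intros) auto
  then obtain \<rho> where \<rho>: "\<rho> > 0" "majorized k \<rho> ?\<epsilon> ?g" by blast
  have "f x \<noteq> 0" if "\<forall>i<k. norm (x i) < \<rho>" for x
    using majorized_norm_le[OF \<rho>(2), of x] that assms(2) by (auto simp: less_imp_le)
  then show ?thesis
    unfolding eventually_near_zero using \<rho>(1) by blast
qed

lemma eventually_near_zero_nonzero_witness:
  assumes "\<forall>\<^sub>F x in near_zero k. P x"
  obtains x :: "nat \<Rightarrow> 'a::real_normed_field" where "P x" "x 0 \<noteq> 0"
proof -
  obtain \<rho> where "\<rho> > 0" "\<And>x :: nat \<Rightarrow> 'a. \<forall>i<k. norm (x i) < \<rho> \<Longrightarrow> P x"
    using assms unfolding eventually_near_zero by blast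
  then show thesis
    using that[of "\<lambda>_. of_real (\<rho> / 2)"] by simp
qed

section \<open>Matrices of power series and changes of basis\<close>

definition cps_mat ::
  "nat \<Rightarrow> nat \<Rightarrow> nat \<Rightarrow> ((nat \<Rightarrow> 'a::real_normed_field) \<Rightarrow> 'a mat) \<Rightarrow> bool" where
  "cps_mat k nr nc M \<longleftrightarrow> (\<forall>x. M x \<in> carrier_mat nr nc) \<and>
     (\<forall>i<nr. \<forall>j<nc. convergent_power_series k (\<lambda>x. M x $$ (i, j)))"

definition near_identity ::
  "nat \<Rightarrow> nat \<Rightarrow> ((nat \<Rightarrow> 'a::real_normed_field) \<Rightarrow> 'a mat) \<Rightarrow> bool" where
  "near_identity k d S \<longleftrightarrow> cps_mat k d d S \<and> S (\<lambda>_. 0) = 1\<^sub>m d"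

lemma cps_mat_carrier: "cps_mat k nr nc M \<Longrightarrow> M x \<in> carrier_mat nr nc"
  by (simp add: cps_mat_def)

lemma near_identity_carrier: "near_identity k d S \<Longrightarrow> S x \<in> carrier_mat d d"
  by (simp add: near_identity_def cps_mat_def)

lemma cps_mat_one: "cps_mat k d d (\<lambda>_. 1\<^sub>m d :: 'a::{real_normed_field,banach} mat)"
  by (auto simp: cps_mat_def intro: cps_intros)

lemma near_identity_one: "near_identity k d (\<lambda>_. 1\<^sub>m d :: 'a::{real_normed_field,banach} mat)"
  by (simp add: near_identity_def cps_mat_one)

lemma cps_mat_mult:
  fixes M N :: "(nat \<Rightarrow> 'a::{real_normed_field,banach}) \<Rightarrow> 'a mat"
  assumes M: "cps_mat k nr nm M" and N: "cps_mat k nm nc N"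
  shows "cps_mat k nr nc (\<lambda>x. M x * N x)"
proof -
  have "(M x * N x) $$ (i, j) = (\<Sum>l\<in>{0..<nm}. M x $$ (i, l) * N x $$ (l, j))"
    if "i < nr" "j < nc" for i j x
    using that cps_mat_carrier[OF M, of x] cps_mat_carrier[OF N, of x]
    by (auto simp: scalar_prod_def intro!: sum.cong)
  moreover have "M x * N x \<in> carrier_mat nr nc" for x
    using cps_mat_carrier[OF M] cps_mat_carrier[OF N] by (rule mult_carrier_mat)
  ultimately show ?thesis
    using M N by (auto simp: cps_mat_def intro!: cps_intros)
qed

lemma near_identity_mult:
  fixes S T :: "(nat \<Rightarrow> 'a::{real_normed_field,banach}) \<Rightarrow> 'a mat"
  assumes "near_identity k d S" "near_identity k d T"
  shows "near_identity k d (\<lambda>x. S x * T x)"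
  using assms by (auto simp: near_identity_def intro: cps_mat_mult)

lemma cps_det:
  fixes M :: "(nat \<Rightarrow> 'a::{real_normed_field,banach}) \<Rightarrow> 'a mat"
  assumes "cps_mat k d d M"
  shows "convergent_power_series k (\<lambda>x. Determinant.det (M x))"
proof -
  have "Determinant.det (M x) =
      (\<Sum>p\<in>{p. p permutes {0..<d}}. signof p * (\<Prod>i\<in>{0..<d}. M x $$ (i, p i)))" for x
    by (rule det_def'[OF cps_mat_carrier[OF assms]])
  moreover have "convergent_power_series k (\<lambda>x. M x $$ (i, p i))"
    if "p permutes {0..<d}" "i \<in> {0..<d}" for p i
    using assms that permutes_in_image[of p "{0..<d}" i] by (auto simp: cps_mat_def)
  ultimately show ?thesis
    by (auto intro!: cps_intros)
qed

lemma cps_cofactor: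
  fixes M :: "(nat \<Rightarrow> 'a::{real_normed_field,banach}) \<Rightarrow> 'a mat"
  assumes M: "cps_mat k d d M" and "i < d" "j < d"
  shows "convergent_power_series k (\<lambda>x. cofactor (M x) i j)"
proof -
  have "dim_row (M x) = d" "dim_col (M x) = d" for x
    using cps_mat_carrier[OF M, of x] by auto
  then have "cps_mat k (d - 1) (d - 1) (\<lambda>x. mat_delete (M x) i j)"
    using M assms by (auto simp: cps_mat_def mat_delete_def)
  then show ?thesis
    unfolding cofactor_def by (intro cps_intros cps_det)
qed

text \<open>Cramer's rule: the determinant is a power series with value \<open>1\<close> at the origin.\<close>

lemma near_identity_inverse:
  fixes S :: "(nat \<Rightarrow> 'a::{real_normed_field,banach}) \<Rightarrow> 'a mat"
  assumes S: "near_identity k d S"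
  obtains J where "near_identity k d J"
    "\<forall>\<^sub>F x in near_zero k. S x * J x = 1\<^sub>m d \<and> J x * S x = 1\<^sub>m d"
proof -
  define J where "J x = inverse (Determinant.det (S x)) \<cdot>\<^sub>m adj_mat (S x)" for x
  have M: "cps_mat k d d S" and S0: "S (\<lambda>_. 0) = 1\<^sub>m d"
    using S by (auto simp: near_identity_def)
  have carr: "S x \<in> carrier_mat d d" for x
    using M by (rule cps_mat_carrier)
  note adj = adj_mat[OF carr]
  have det0: "Determinant.det (S (\<lambda>_. 0)) = 1"
    by (simp add: S0)
  have J: "cps_mat k d d J"
    unfolding cps_mat_def
  proof (intro conjI allI impI)
    show "J x \<in> carrier_mat d d" for x
      using adj(1) by (simp add: J_def)
    fix i j assume ij: "i < d" "j < d"
    have "J x $$ (i, j) = inverse (Determinant.det (S x)) * cofactor (S x) j i" for x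
      using ij carr[of x] adj(1)[of x] by (simp add: J_def adj_mat_def)
    then show "convergent_power_series k (\<lambda>x. J x $$ (i, j))"
      using ij M by (simp, intro cps_intros cps_det cps_cofactor) (auto simp: det0)
  qed
  have prods: "S x * J x = 1\<^sub>m d \<and> J x * S x = 1\<^sub>m d" if "Determinant.det (S x) \<noteq> 0" for x
  proof -
    have "inverse a \<cdot>\<^sub>m (a \<cdot>\<^sub>m 1\<^sub>m d) = 1\<^sub>m d" if "a \<noteq> 0" for a :: 'a
      using that by (intro eq_matI) auto
    then show ?thesis
      using that adj[of x] carr[of x] unfolding J_def
      by (simp add: mult_smult_distrib[of _ d d _ d] mult_smult_assoc_mat[of _ d d _ d])
  qed
  have "J (\<lambda>_. 0) = 1\<^sub>m d"
    using prods[of "\<lambda>_. 0"] left_mult_one_mat[OF cps_mat_carrier[OF J]] by (simp add: S0)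
  with J have "near_identity k d J" by (simp add: near_identity_def)
  moreover have "\<forall>\<^sub>F x in near_zero k. S x * J x = 1\<^sub>m d \<and> J x * S x = 1\<^sub>m d"
    by (rule eventually_mono[OF cps_eventually_nonzero[OF cps_det[OF M]]]) (use prods in \<open>auto simp: det0\<close>)
  ultimately show thesis by (rule that)
qed

section \<open>Equivalence of deformations\<close>

lemma deformation_iff:
  "deformation Q n k A D \<longleftrightarrow>
     (\<forall>\<alpha>\<in>arcs Q. cps_mat k (n (head Q \<alpha>)) (n (tail Q \<alpha>)) (\<lambda>x. D x \<alpha>) \<and> D (\<lambda>_. 0) \<alpha> = A \<alpha>)"
  by (auto simp: deformation_def matrix_rep_def cps_mat_def)

lemma deformation_carrier:
  "deformation Q n k A D \<Longrightarrow> \<alpha> \<in> arcs Q \<Longrightarrow>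
    D x \<alpha> \<in> carrier_mat (n (head Q \<alpha>)) (n (tail Q \<alpha>))"
  by (simp add: deformation_iff cps_mat_def)

text \<open>Near the origin a change of basis is invertible anyway, so equivalence can be stated without
  inverses. In this form it is easy to verify, to compose and to refute.\<close>

definition intertwines ::
  "('v, 'e) pre_digraph \<Rightarrow> ('v \<Rightarrow> nat) \<Rightarrow> nat \<Rightarrow> ('v \<Rightarrow> (nat \<Rightarrow> 'a::real_normed_field) \<Rightarrow> 'a mat) \<Rightarrow>
   ((nat \<Rightarrow> 'a) \<Rightarrow> 'e \<Rightarrow> 'a mat) \<Rightarrow> ((nat \<Rightarrow> 'a) \<Rightarrow> 'e \<Rightarrow> 'a mat) \<Rightarrow> bool" where
  "intertwines Q n k S D E \<longleftrightarrow> (\<forall>v\<in>verts Q. near_identity k (n v) (S v)) \<and>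
     (\<forall>\<^sub>F x in near_zero k. \<forall>\<alpha>\<in>arcs Q. E x \<alpha> * S (tail Q \<alpha>) x = S (head Q \<alpha>) x * D x \<alpha>)"

lemma equivalent_imp_intertwines:
  fixes D E :: "(nat \<Rightarrow> 'a::{real_normed_field,banach}) \<Rightarrow> 'e \<Rightarrow> 'a mat"
  assumes "wf_digraph Q" and D: "deformation Q n k A D"
    and eq: "equivalent_deformations Q n k D E"
  shows "\<exists>S. intertwines Q n k S D E"
proof -
  interpret wf_digraph Q by fact
  obtain S where S: "\<And>v. v \<in> verts Q \<Longrightarrow> near_identity k (n v) (S v)"
    and ev: "\<forall>\<^sub>F x in near_zero k. \<forall>\<alpha>\<in>arcs Q. \<exists>J\<in>carrier_mat (n (tail Q \<alpha>)) (n (tail Q \<alpha>)).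
      inverts_mat (S (tail Q \<alpha>) x) J \<and> inverts_mat J (S (tail Q \<alpha>) x) \<and>
      E x \<alpha> = S (head Q \<alpha>) x * D x \<alpha> * J"
    using eq unfolding equivalent_deformations_def eventually_near_zero near_identity_def cps_mat_def
    by blast
  have "\<forall>\<^sub>F x in near_zero k. \<forall>\<alpha>\<in>arcs Q. E x \<alpha> * S (tail Q \<alpha>) x = S (head Q \<alpha>) x * D x \<alpha>"
    using ev
  proof (eventually_elim, intro ballI)
    fix x \<alpha> assume x: "\<forall>\<alpha>\<in>arcs Q. \<exists>J\<in>carrier_mat (n (tail Q \<alpha>)) (n (tail Q \<alpha>)).
      inverts_mat (S (tail Q \<alpha>) x) J \<and> inverts_mat J (S (tail Q \<alpha>) x) \<and>
      E x \<alpha> = S (head Q \<alpha>) x * D x \<alpha> * J" and \<alpha>: "\<alpha> \<in> arcs Q"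
    let ?h = "n (head Q \<alpha>)" and ?t = "n (tail Q \<alpha>)"
    obtain J where J: "J \<in> carrier_mat ?t ?t" "inverts_mat J (S (tail Q \<alpha>) x)"
      "E x \<alpha> = S (head Q \<alpha>) x * D x \<alpha> * J"
      using x \<alpha> by blast
    have c: "S (head Q \<alpha>) x \<in> carrier_mat ?h ?h" "S (tail Q \<alpha>) x \<in> carrier_mat ?t ?t"
      "D x \<alpha> \<in> carrier_mat ?h ?t"
      using near_identity_carrier[OF S] deformation_carrier[OF D] \<alpha> by auto
    have "E x \<alpha> * S (tail Q \<alpha>) x = S (head Q \<alpha>) x * D x \<alpha> * (J * S (tail Q \<alpha>) x)"
      unfolding J(3) using J(1) c by (rule_tac assoc_mult_mat) auto
    also have "J * S (tail Q \<alpha>) x = 1\<^sub>m ?t"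
      using J by (simp add: inverts_mat_def)
    finally show "E x \<alpha> * S (tail Q \<alpha>) x = S (head Q \<alpha>) x * D x \<alpha>"
      using c by simp
  qed
  with S show ?thesis unfolding intertwines_def by blast
qed

lemma intertwines_imp_equivalent:
  fixes D E :: "(nat \<Rightarrow> 'a::{real_normed_field,banach}) \<Rightarrow> 'e \<Rightarrow> 'a mat"
  assumes "fin_digraph Q" and E: "\<And>x. matrix_rep Q n (E x)"
    and S: "intertwines Q n k S D E"
  shows "equivalent_deformations Q n k D E"
proof -
  interpret fin_digraph Q by fact
  have nid: "near_identity k (n v) (S v)" if "v \<in> verts Q" for v
    using S that by (simp add: intertwines_def)
  have "\<forall>\<^sub>F x in near_zero k. \<exists>J\<in>carrier_mat (n v) (n v).
      S v x * J = 1\<^sub>m (n v) \<and> J * S v x = 1\<^sub>m (n v)" if v: "v \<in> verts Q" for v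
  proof -
    obtain J where J: "near_identity k (n v) J"
      "\<forall>\<^sub>F x in near_zero k. S v x * J x = 1\<^sub>m (n v) \<and> J x * S v x = 1\<^sub>m (n v)"
      using near_identity_inverse[OF nid[OF v]] .
    from J(2) show ?thesis
      by (rule eventually_mono) (use near_identity_carrier[OF J(1)] in blast)
  qed
  then have "\<forall>\<^sub>F x in near_zero k. \<forall>v\<in>verts Q. \<exists>J\<in>carrier_mat (n v) (n v).
      S v x * J = 1\<^sub>m (n v) \<and> J * S v x = 1\<^sub>m (n v)"
    by (intro eventually_ball_finite) auto
  moreover have "\<forall>\<^sub>F x in near_zero k. \<forall>\<alpha>\<in>arcs Q. E x \<alpha> * S (tail Q \<alpha>) x = S (head Q \<alpha>) x * D x \<alpha>"
    using S by (simp add: intertwines_def)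
  ultimately have "\<forall>\<^sub>F x in near_zero k. \<forall>\<alpha>\<in>arcs Q.
      \<exists>J\<in>carrier_mat (n (tail Q \<alpha>)) (n (tail Q \<alpha>)).
      inverts_mat (S (tail Q \<alpha>) x) J \<and> inverts_mat J (S (tail Q \<alpha>) x) \<and>
      E x \<alpha> = S (head Q \<alpha>) x * D x \<alpha> * J"
  proof (eventually_elim, intro ballI)
    fix x \<alpha> assume inv: "\<forall>v\<in>verts Q. \<exists>J\<in>carrier_mat (n v) (n v).
      S v x * J = 1\<^sub>m (n v) \<and> J * S v x = 1\<^sub>m (n v)"
      and eq: "\<forall>\<alpha>\<in>arcs Q. E x \<alpha> * S (tail Q \<alpha>) x = S (head Q \<alpha>) x * D x \<alpha>"
      and \<alpha>: "\<alpha> \<in> arcs Q"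
    let ?h = "n (head Q \<alpha>)" and ?t = "n (tail Q \<alpha>)"
    obtain J where J: "J \<in> carrier_mat ?t ?t"
      "S (tail Q \<alpha>) x * J = 1\<^sub>m ?t" "J * S (tail Q \<alpha>) x = 1\<^sub>m ?t"
      using bspec[OF inv tail_in_verts[OF \<alpha>]] by (elim bexE conjE)
    have c: "S (tail Q \<alpha>) x \<in> carrier_mat ?t ?t" "E x \<alpha> \<in> carrier_mat ?h ?t"
      using near_identity_carrier[OF nid[OF tail_in_verts[OF \<alpha>]]] \<alpha> E
      by (simp_all add: matrix_rep_def)
    have "S (head Q \<alpha>) x * D x \<alpha> * J = E x \<alpha> * S (tail Q \<alpha>) x * J"
      using eq \<alpha> by simp
    also have "\<dots> = E x \<alpha> * (S (tail Q \<alpha>) x * J)"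
      using c J(1) by (rule_tac assoc_mult_mat) auto
    also have "\<dots> = E x \<alpha>"
      using c J(2) by simp
    finally show "\<exists>J\<in>carrier_mat ?t ?t. inverts_mat (S (tail Q \<alpha>) x) J \<and>
        inverts_mat J (S (tail Q \<alpha>) x) \<and> E x \<alpha> = S (head Q \<alpha>) x * D x \<alpha> * J"
      using J c by (intro bexI[of _ J]) (auto simp: inverts_mat_def)
  qed
  then have "\<exists>r>0. \<forall>x. (\<forall>i<k. norm (x i) < r) \<longrightarrow> (\<forall>\<alpha>\<in>arcs Q.
      \<exists>J\<in>carrier_mat (n (tail Q \<alpha>)) (n (tail Q \<alpha>)).
      inverts_mat (S (tail Q \<alpha>) x) J \<and> inverts_mat J (S (tail Q \<alpha>) x) \<and>
      E x \<alpha> = S (head Q \<alpha>) x * D x \<alpha> * J)"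
    by (simp only: eventually_near_zero)
  moreover have "\<forall>v\<in>verts Q. (\<forall>x. S v x \<in> carrier_mat (n v) (n v)) \<and>
      (\<forall>i<n v. \<forall>j<n v. convergent_power_series k (\<lambda>x. S v x $$ (i, j))) \<and>
      S v (\<lambda>_. 0) = 1\<^sub>m (n v)"
    using nid unfolding near_identity_def cps_mat_def by simp
  ultimately show ?thesis
    unfolding equivalent_deformations_def by (intro exI[of _ S] conjI)
qed

lemma intertwines_trans:
  fixes D E F :: "(nat \<Rightarrow> 'a::{real_normed_field,banach}) \<Rightarrow> 'e \<Rightarrow> 'a mat"
  assumes "wf_digraph Q" and reps: "\<And>x. matrix_rep Q n (D x)" "\<And>x. matrix_rep Q n (E x)"
      "\<And>x. matrix_rep Q n (F x)"
    and S: "intertwines Q n k S D E" and T: "intertwines Q n k T E F"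
  shows "intertwines Q n k (\<lambda>v x. T v x * S v x) D F"
proof -
  interpret wf_digraph Q by fact
  have Sv: "near_identity k (n v) (S v)" and Tv: "near_identity k (n v) (T v)"
    if "v \<in> verts Q" for v
    using S T that by (simp_all add: intertwines_def)
  have "\<forall>\<^sub>F x in near_zero k. \<forall>\<alpha>\<in>arcs Q. E x \<alpha> * S (tail Q \<alpha>) x = S (head Q \<alpha>) x * D x \<alpha>"
    "\<forall>\<^sub>F x in near_zero k. \<forall>\<alpha>\<in>arcs Q. F x \<alpha> * T (tail Q \<alpha>) x = T (head Q \<alpha>) x * E x \<alpha>"
    using S T by (simp_all add: intertwines_def)
  then have "\<forall>\<^sub>F x in near_zero k. \<forall>\<alpha>\<in>arcs Q.
      F x \<alpha> * (T (tail Q \<alpha>) x * S (tail Q \<alpha>) x) = (T (head Q \<alpha>) x * S (head Q \<alpha>) x) * D x \<alpha>"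
  proof (eventually_elim, intro ballI)
    fix x \<alpha>
    assume 1: "\<forall>\<alpha>\<in>arcs Q. E x \<alpha> * S (tail Q \<alpha>) x = S (head Q \<alpha>) x * D x \<alpha>"
      and 2: "\<forall>\<alpha>\<in>arcs Q. F x \<alpha> * T (tail Q \<alpha>) x = T (head Q \<alpha>) x * E x \<alpha>"
      and \<alpha>: "\<alpha> \<in> arcs Q"
    let ?h = "n (head Q \<alpha>)" and ?t = "n (tail Q \<alpha>)"
    have c: "S (head Q \<alpha>) x \<in> carrier_mat ?h ?h" "S (tail Q \<alpha>) x \<in> carrier_mat ?t ?t"
      "T (head Q \<alpha>) x \<in> carrier_mat ?h ?h" "T (tail Q \<alpha>) x \<in> carrier_mat ?t ?t"
      "D x \<alpha> \<in> carrier_mat ?h ?t" "E x \<alpha> \<in> carrier_mat ?h ?t" "F x \<alpha> \<in> carrier_mat ?h ?t"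
      using near_identity_carrier[OF Sv[OF head_in_verts[OF \<alpha>]]]
        near_identity_carrier[OF Sv[OF tail_in_verts[OF \<alpha>]]]
        near_identity_carrier[OF Tv[OF head_in_verts[OF \<alpha>]]]
        near_identity_carrier[OF Tv[OF tail_in_verts[OF \<alpha>]]] \<alpha> reps
      by (simp_all add: matrix_rep_def)
    have "F x \<alpha> * (T (tail Q \<alpha>) x * S (tail Q \<alpha>) x) = F x \<alpha> * T (tail Q \<alpha>) x * S (tail Q \<alpha>) x"
      using c by (rule_tac assoc_mult_mat[symmetric]) auto
    also have "\<dots> = T (head Q \<alpha>) x * E x \<alpha> * S (tail Q \<alpha>) x"
      using 2 \<alpha> by simp
    also have "\<dots> = T (head Q \<alpha>) x * (E x \<alpha> * S (tail Q \<alpha>) x)"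
      using c by (rule_tac assoc_mult_mat) auto
    also have "\<dots> = T (head Q \<alpha>) x * (S (head Q \<alpha>) x * D x \<alpha>)"
      using 1 \<alpha> by simp
    also have "\<dots> = T (head Q \<alpha>) x * S (head Q \<alpha>) x * D x \<alpha>"
      using c by (rule_tac assoc_mult_mat[symmetric]) auto
    finally show "F x \<alpha> * (T (tail Q \<alpha>) x * S (tail Q \<alpha>) x)
        = (T (head Q \<alpha>) x * S (head Q \<alpha>) x) * D x \<alpha>" .
  qed
  moreover have "near_identity k (n v) (\<lambda>x. T v x * S v x)" if "v \<in> verts Q" for v
    using Tv[OF that] Sv[OF that] by (rule near_identity_mult)
  ultimately show ?thesis
    by (simp add: intertwines_def)
qed

text \<open>A change of basis may be applied to any deformation; invertibility is only local, so the
  transformed family is defined with the power series inverse.\<close>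

lemma deformation_transport:
  fixes D :: "(nat \<Rightarrow> 'a::{real_normed_field,banach}) \<Rightarrow> 'e \<Rightarrow> 'a mat"
  assumes "fin_digraph Q" and D: "deformation Q n k A D"
    and A: "matrix_rep Q n A" and S: "\<And>v. v \<in> verts Q \<Longrightarrow> near_identity k (n v) (S v)"
  obtains E where "deformation Q n k A E" "intertwines Q n k S D E"
proof -
  interpret fin_digraph Q by fact
  have "\<forall>v\<in>verts Q. \<exists>J. near_identity k (n v) J \<and> (\<forall>\<^sub>F x in near_zero k. J x * S v x = 1\<^sub>m (n v))"
  proof
    fix v assume "v \<in> verts Q"
    from near_identity_inverse[OF S[OF this]] obtain J where "near_identity k (n v) J"
      "\<forall>\<^sub>F x in near_zero k. S v x * J x = 1\<^sub>m (n v) \<and> J x * S v x = 1\<^sub>m (n v)" .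
    then show "\<exists>J. near_identity k (n v) J \<and> (\<forall>\<^sub>F x in near_zero k. J x * S v x = 1\<^sub>m (n v))"
      by (auto elim: eventually_mono)
  qed
  from bchoice[OF this] obtain J where
    J: "\<And>v. v \<in> verts Q \<Longrightarrow> near_identity k (n v) (J v)"
      "\<And>v. v \<in> verts Q \<Longrightarrow> \<forall>\<^sub>F x in near_zero k. J v x * S v x = 1\<^sub>m (n v)"
    by blast
  define E where "E x \<alpha> = S (head Q \<alpha>) x * D x \<alpha> * J (tail Q \<alpha>) x" for x \<alpha>
  have "deformation Q n k A E"
    unfolding deformation_iff
  proof
    fix \<alpha> assume \<alpha>: "\<alpha> \<in> arcs Q"
    have "cps_mat k (n (head Q \<alpha>)) (n (tail Q \<alpha>)) (\<lambda>x. E x \<alpha>)"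
      unfolding E_def using \<alpha> S J(1) D
      by (intro cps_mat_mult) (auto simp: near_identity_def deformation_iff)
    moreover have "E (\<lambda>_. 0) \<alpha> = A \<alpha>"
      using \<alpha> S[of "head Q \<alpha>"] J(1)[of "tail Q \<alpha>"] D A
      by (auto simp: E_def near_identity_def deformation_iff matrix_rep_def)
    ultimately show "cps_mat k (n (head Q \<alpha>)) (n (tail Q \<alpha>)) (\<lambda>x. E x \<alpha>) \<and> E (\<lambda>_. 0) \<alpha> = A \<alpha>" ..
  qed
  moreover have "intertwines Q n k S D E"
    unfolding intertwines_def
  proof (intro conjI ballI S eventually_ball_finite)
    fix \<alpha> assume \<alpha>: "\<alpha> \<in> arcs Q"
    have "\<forall>\<^sub>F x in near_zero k. J (tail Q \<alpha>) x * S (tail Q \<alpha>) x = 1\<^sub>m (n (tail Q \<alpha>))"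
      using J(2) \<alpha> by auto
    then show "\<forall>\<^sub>F x in near_zero k. E x \<alpha> * S (tail Q \<alpha>) x = S (head Q \<alpha>) x * D x \<alpha>"
    proof eventually_elim
      fix x assume x: "J (tail Q \<alpha>) x * S (tail Q \<alpha>) x = 1\<^sub>m (n (tail Q \<alpha>))"
      let ?h = "n (head Q \<alpha>)" and ?t = "n (tail Q \<alpha>)"
      have c: "S (head Q \<alpha>) x \<in> carrier_mat ?h ?h" "S (tail Q \<alpha>) x \<in> carrier_mat ?t ?t"
        "J (tail Q \<alpha>) x \<in> carrier_mat ?t ?t" "D x \<alpha> \<in> carrier_mat ?h ?t"
        using near_identity_carrier[OF S] near_identity_carrier[OF J(1)] deformation_carrier[OF D] \<alpha>
        by auto
      have "E x \<alpha> * S (tail Q \<alpha>) x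
          = S (head Q \<alpha>) x * D x \<alpha> * (J (tail Q \<alpha>) x * S (tail Q \<alpha>) x)"
        unfolding E_def using c by (rule_tac assoc_mult_mat) auto
      then show "E x \<alpha> * S (tail Q \<alpha>) x = S (head Q \<alpha>) x * D x \<alpha>"
        using c x by simp
    qed
  qed auto
  ultimately show thesis by (rule that)
qed

section \<open>Straightening along a chain\<close>

lemma chain_quiver_simps [simp]:
  "verts (chain_quiver t fwd) = {1..t}" "arcs (chain_quiver t fwd) = {1..<t}"
  "tail (chain_quiver t fwd) \<alpha> = (if fwd \<alpha> then \<alpha> else \<alpha> + 1)"
  "head (chain_quiver t fwd) \<alpha> = (if fwd \<alpha> then \<alpha> + 1 else \<alpha>)"
  by (auto simp: chain_quiver_def)

lemma fin_digraph_chain_quiver: "fin_digraph (chain_quiver t fwd)"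
  by unfold_locales auto

text \<open>A chain has no cycles: walking along it, the basis of each vertex can be chosen such that the
  arrow that leads to it from the previous vertex becomes the identity matrix, whenever this
  arrow carries the identity matrix in the undeformed representation.\<close>

lemma chain_straightening:
  fixes B :: "(nat \<Rightarrow> 'a::{real_normed_field,banach}) \<Rightarrow> nat \<Rightarrow> 'a mat" and n :: "nat \<Rightarrow> nat"
  assumes B: "deformation (chain_quiver t fwd) n k A B"
    and A: "matrix_rep (chain_quiver t fwd) n A"
  obtains S E where "deformation (chain_quiver t fwd) n k A E"
    "intertwines (chain_quiver t fwd) n k S B E"
    "\<And>\<alpha> x. \<alpha> \<in> {1..<t} \<Longrightarrow> n (\<alpha> + 1) = n \<alpha> \<Longrightarrow> A \<alpha> = 1\<^sub>m (n \<alpha>) \<Longrightarrow> E x \<alpha> = 1\<^sub>m (n \<alpha>)"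
proof -
  let ?Q = "chain_quiver t fwd"
  define flat where "flat \<alpha> \<longleftrightarrow> \<alpha> \<in> {1..<t} \<and> n (\<alpha> + 1) = n \<alpha> \<and> A \<alpha> = 1\<^sub>m (n \<alpha>)" for \<alpha>
  have nid: "near_identity k (n \<alpha>) (\<lambda>x. B x \<alpha>)" if "flat \<alpha>" for \<alpha>
  proof -
    have "cps_mat k (n (head ?Q \<alpha>)) (n (tail ?Q \<alpha>)) (\<lambda>x. B x \<alpha>) \<and> B (\<lambda>_. 0) \<alpha> = A \<alpha>"
      using that B by (simp only: deformation_iff flat_def chain_quiver_simps)
    then show ?thesis
      using that by (auto simp: flat_def near_identity_def split: if_splits)
  qed
  have "\<forall>\<alpha>\<in>Collect flat. \<exists>J. near_identity k (n \<alpha>) J \<and>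
      (\<forall>\<^sub>F x in near_zero k. J x * B x \<alpha> = 1\<^sub>m (n \<alpha>))"
  proof
    fix \<alpha> assume "\<alpha> \<in> Collect flat"
    then have "flat \<alpha>" by simp
    from near_identity_inverse[OF nid[OF this]] obtain J where "near_identity k (n \<alpha>) J"
      "\<forall>\<^sub>F x in near_zero k. B x \<alpha> * J x = 1\<^sub>m (n \<alpha>) \<and> J x * B x \<alpha> = 1\<^sub>m (n \<alpha>)" .
    then show "\<exists>J. near_identity k (n \<alpha>) J \<and> (\<forall>\<^sub>F x in near_zero k. J x * B x \<alpha> = 1\<^sub>m (n \<alpha>))"
      by (auto elim: eventually_mono)
  qed
  from bchoice[OF this] obtain J where
    J: "\<And>\<alpha>. flat \<alpha> \<Longrightarrow> near_identity k (n \<alpha>) (J \<alpha>)"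
      "\<And>\<alpha>. flat \<alpha> \<Longrightarrow> \<forall>\<^sub>F x in near_zero k. J \<alpha> x * B x \<alpha> = 1\<^sub>m (n \<alpha>)"
    by blast
  define S where "S = rec_nat (\<lambda>x. 1\<^sub>m (n 0)) (\<lambda>v Sv x.
    if flat v then if fwd v then Sv x * J v x else Sv x * B x v else 1\<^sub>m (n (Suc v)))"
  have S_Suc: "S (Suc v) = (\<lambda>x. if flat v then if fwd v then S v x * J v x else S v x * B x v
      else 1\<^sub>m (n (Suc v)))" for v
    unfolding S_def by (simp only: old.nat.rec)
  have S: "near_identity k (n v) (S v)" for v
  proof (induction v)
    case 0
    show ?case by (simp add: S_def near_identity_one)
  next
    case (Suc v)
    show ?case
    proof (cases "flat v")
      case True
      then have "n (Suc v) = n v" by (simp add: flat_def)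
      then show ?thesis
        using True Suc J(1) nid by (cases "fwd v") (auto simp: S_Suc intro!: near_identity_mult)
    qed (simp add: S_Suc near_identity_one)
  qed
  obtain E where E: "deformation ?Q n k A E" "intertwines ?Q n k S B E"
    using deformation_transport[OF fin_digraph_chain_quiver, of t fwd n k A B S] B A S
    by blast
  define E' where "E' x \<alpha> = (if flat \<alpha> then 1\<^sub>m (n \<alpha>) else E x \<alpha>)" for x \<alpha>
  have "deformation ?Q n k A E'"
    unfolding deformation_iff
  proof
    fix \<alpha> assume \<alpha>: "\<alpha> \<in> arcs ?Q"
    show "cps_mat k (n (head ?Q \<alpha>)) (n (tail ?Q \<alpha>)) (\<lambda>x. E' x \<alpha>) \<and> E' (\<lambda>_. 0) \<alpha> = A \<alpha>"
    proof (cases "flat \<alpha>")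
      case True
      then show ?thesis
        using cps_mat_one[of k "n \<alpha>"] by (auto simp: E'_def flat_def)
    qed (use E(1) \<alpha> in \<open>simp add: E'_def deformation_iff\<close>)
  qed
  moreover have "intertwines ?Q n k S B E'"
    unfolding intertwines_def
  proof (intro conjI ballI S eventually_ball_finite)
    fix \<alpha> assume \<alpha>: "\<alpha> \<in> arcs ?Q"
    show "\<forall>\<^sub>F x in near_zero k. E' x \<alpha> * S (tail ?Q \<alpha>) x = S (head ?Q \<alpha>) x * B x \<alpha>"
    proof (cases "flat \<alpha>")
      case True
      then have n: "n (Suc \<alpha>) = n \<alpha>" by (simp add: flat_def)
      have c: "S \<alpha> x \<in> carrier_mat (n \<alpha>) (n \<alpha>)" "J \<alpha> x \<in> carrier_mat (n \<alpha>) (n \<alpha>)"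
        "B x \<alpha> \<in> carrier_mat (n \<alpha>) (n \<alpha>)" for x
        using near_identity_carrier[OF S] near_identity_carrier[OF J(1)[OF True]]
          near_identity_carrier[OF nid[OF True]] by auto
      show ?thesis
        using J(2)[OF True]
      proof eventually_elim
        fix x assume x: "J \<alpha> x * B x \<alpha> = 1\<^sub>m (n \<alpha>)"
        have "S \<alpha> x * J \<alpha> x * B x \<alpha> = S \<alpha> x * (J \<alpha> x * B x \<alpha>)"
          using c[of x] by (rule_tac assoc_mult_mat) auto
        with x show "E' x \<alpha> * S (tail ?Q \<alpha>) x = S (head ?Q \<alpha>) x * B x \<alpha>"
          using True c[of x] n by (auto simp: E'_def S_Suc)
      qed
    next
      case False
      have "\<forall>\<^sub>F x in near_zero k. \<forall>\<alpha>\<in>arcs ?Q. E x \<alpha> * S (tail ?Q \<alpha>) x = S (head ?Q \<alpha>) x * B x \<alpha>"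
        using E(2) unfolding intertwines_def by (rule conjunct2)
      then show ?thesis
      proof eventually_elim
        fix x assume "\<forall>\<alpha>\<in>arcs ?Q. E x \<alpha> * S (tail ?Q \<alpha>) x = S (head ?Q \<alpha>) x * B x \<alpha>"
        from bspec[OF this \<alpha>] show "E' x \<alpha> * S (tail ?Q \<alpha>) x = S (head ?Q \<alpha>) x * B x \<alpha>"
          by (simp only: E'_def False if_False)
      qed
    qed
  qed auto
  ultimately show thesis
    using that[of E' S] by (auto simp: E'_def flat_def)
qed

section \<open>A plane with two lines attached\<close>

text \<open>A vertex of dimension \<open>2\<close> is joined to a vertex of dimension \<open>1\<close> by a column (arrow into the
  plane) or a row (arrow out of the plane). The predicate says that the basis changes \<open>G\<close> of the
  plane and \<open>s\<close> of the line turn the vector \<open>b\<close> into \<open>d\<close>.\<close>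

definition carries ::
  "bool \<Rightarrow> (nat \<Rightarrow> nat \<Rightarrow> 'a::comm_ring_1) \<Rightarrow> 'a \<Rightarrow> (nat \<Rightarrow> 'a) \<Rightarrow> (nat \<Rightarrow> 'a) \<Rightarrow> bool" where
  "carries into G s b d \<longleftrightarrow>
     (if into then \<forall>i<2. d i * s = G i 0 * b 0 + G i 1 * b 1
      else \<forall>j<2. d 0 * G 0 j + d 1 * G 1 j = s * b j)"

lemma carries_cong:
  assumes "\<And>i j. i < 2 \<Longrightarrow> j < 2 \<Longrightarrow> G i j = G' i j" "s = s'"
    and "\<And>i. i < 2 \<Longrightarrow> b i = b' i" "\<And>i. i < 2 \<Longrightarrow> d i = d' i"
  shows "carries into G s b d \<longleftrightarrow> carries into G' s' b' d'"
  using assms by (simp add: carries_def)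

lemma carries_iff:
  fixes E B G S :: "'a::comm_ring_1 mat"
  assumes "E \<in> carrier_mat (if into then 2 else 1) (if into then 1 else 2)"
    and "B \<in> carrier_mat (if into then 2 else 1) (if into then 1 else 2)"
    and "G \<in> carrier_mat 2 2" "S \<in> carrier_mat 1 1"
  shows "E * (if into then S else G) = (if into then G else S) * B \<longleftrightarrow>
    carries into (\<lambda>i j. G $$ (i, j)) (S $$ (0, 0))
      (\<lambda>i. B $$ (if into then (i, 0) else (0, i))) (\<lambda>i. E $$ (if into then (i, 0) else (0, i)))"
  using assms
  by (cases into) (auto simp: carries_def mat_eq_iff scalar_prod_def numeral_2_eq_2 less_Suc_eq)

text \<open>Two vectors at the plane, \<open>b\<close> close to the unit vector \<open>0\<close> and \<open>c\<close> close to the unit vector \<open>e\<close>,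
  are to be brought to normal form; \<open>u\<close> and \<open>w\<close> tell whether \<open>b\<close> and \<open>c\<close> are columns. A column and a row are
  classified by whether their product is \<open>0\<close>, two columns or two rows by whether they are
  proportional. Being degenerate in this sense is destroyed by a small deformation, being
  nondegenerate is not. So a parameter survives exactly for a row and a column with product \<open>0\<close>
  (\<open>e = 1\<close>) and for two proportional columns or rows (\<open>e = 0\<close>): the entry that measures the deviation
  from degeneracy.\<close>

lemma plane_normal_form:
  fixes b c :: "nat \<Rightarrow> (nat \<Rightarrow> 'a::{real_normed_field,banach}) \<Rightarrow> 'a" and u w :: bool and e l :: nat
  assumes b: "\<And>i. i < 2 \<Longrightarrow> convergent_power_series l (b i)" "b 0 (\<lambda>_. 0) = 1" "b 1 (\<lambda>_. 0) = 0"
    and c: "\<And>i. i < 2 \<Longrightarrow> convergent_power_series l (c i)" "c e (\<lambda>_. 0) = 1" "c (1 - e) (\<lambda>_. 0) = 0"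
    and e: "e < 2"
  obtains G s\<^sub>1 s\<^sub>2 \<phi> where
    "\<And>i j. i < 2 \<Longrightarrow> j < 2 \<Longrightarrow> convergent_power_series l (G i j)"
    "\<And>i j. i < 2 \<Longrightarrow> j < 2 \<Longrightarrow> G i j (\<lambda>_. 0) = (if i = j then 1 else 0)"
    "convergent_power_series l s\<^sub>1" "s\<^sub>1 (\<lambda>_. 0) = 1"
    "convergent_power_series l s\<^sub>2" "s\<^sub>2 (\<lambda>_. 0) = 1"
    "convergent_power_series l \<phi>" "\<phi> (\<lambda>_. 0) = 0"
    "\<not> (if e = 0 then u = w else u \<noteq> w) \<Longrightarrow> \<phi> = (\<lambda>_. 0)"
    "\<forall>\<^sub>F x in near_zero l.
       carries u (\<lambda>i j. G i j x) (s\<^sub>1 x) (\<lambda>i. b i x) (\<lambda>i. if i = 0 then 1 else 0) \<and>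
       carries w (\<lambda>i j. G i j x) (s\<^sub>2 x) (\<lambda>i. c i x) (\<lambda>i. if i = e then 1 else \<phi> x)"
proof -
  note exhibit = that
  have cps: "convergent_power_series l (b 0)" "convergent_power_series l (b 1)"
    "convergent_power_series l (c 0)" "convergent_power_series l (c 1)"
    using b c by auto
  have nz: "\<forall>\<^sub>F x in near_zero l. b 0 x \<noteq> 0 \<and> c e x \<noteq> 0"
    using b c e by (intro eventually_conj cps_eventually_nonzero) auto
  have result: thesis
    if g: "convergent_power_series l g00" "convergent_power_series l g01"
          "convergent_power_series l g10" "convergent_power_series l g11"
      and g0: "g00 (\<lambda>_. 0) = 1" "g01 (\<lambda>_. 0) = 0" "g10 (\<lambda>_. 0) = 0" "g11 (\<lambda>_. 0) = 1"
      and s: "convergent_power_series l s\<^sub>1" "s\<^sub>1 (\<lambda>_. 0) = 1"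
             "convergent_power_series l s\<^sub>2" "s\<^sub>2 (\<lambda>_. 0) = 1"
      and \<phi>: "convergent_power_series l \<phi>" "\<phi> (\<lambda>_. 0) = 0"
             "\<not> (if e = 0 then u = w else u \<noteq> w) \<Longrightarrow> \<phi> = (\<lambda>_. 0)"
      and eqs: "\<And>x. b 0 x \<noteq> 0 \<Longrightarrow> c e x \<noteq> 0 \<Longrightarrow>
        (let G = (\<lambda>i j. if i = 0 then if j = 0 then g00 x else g01 x
                     else if j = 0 then g10 x else g11 x) in
         carries u G (s\<^sub>1 x) (\<lambda>i. b i x) (\<lambda>i. if i = 0 then 1 else 0) \<and>
         carries w G (s\<^sub>2 x) (\<lambda>i. c i x) (\<lambda>i. if i = e then 1 else \<phi> x))"
    for g00 g01 g10 g11 s\<^sub>1 s\<^sub>2 \<phi> :: "(nat \<Rightarrow> 'a) \<Rightarrow> 'a"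
  proof (rule exhibit[of "\<lambda>i j x. if i = 0 then if j = 0 then g00 x else g01 x
                               else if j = 0 then g10 x else g11 x" s\<^sub>1 s\<^sub>2 \<phi>])
    show "\<forall>\<^sub>F x in near_zero l.
       carries u (\<lambda>i j. if i = 0 then if j = 0 then g00 x else g01 x
                     else if j = 0 then g10 x else g11 x) (s\<^sub>1 x) (\<lambda>i. b i x)
         (\<lambda>i. if i = 0 then 1 else 0) \<and>
       carries w (\<lambda>i j. if i = 0 then if j = 0 then g00 x else g01 x
                     else if j = 0 then g10 x else g11 x) (s\<^sub>2 x) (\<lambda>i. c i x)
         (\<lambda>i. if i = e then 1 else \<phi> x)"
      using nz by eventually_elim (use eqs in \<open>simp add: Let_def\<close>)
  qed (use g g0 s \<phi> in \<open>auto simp: less_2_cases_iff\<close>)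
  consider "e = 1" | "e = 0" using e by linarith
  then show thesis
  proof cases
    case 1
    note c0 = c(2,3)[unfolded 1, simplified]
    show thesis
    proof (cases u; cases w)
      assume u: u w
      \<comment> \<open>Two independent columns: \<open>G\<close> inverts the matrix with columns \<open>b\<close> and \<open>c\<close> up to scaling of its rows.\<close>
      show thesis
        by (rule result[of "\<lambda>_. 1" "\<lambda>x. - (c 0 x / c 1 x)" "\<lambda>x. - (b 1 x / b 0 x)" "\<lambda>_. 1"
              "\<lambda>x. b 0 x - c 0 x / c 1 x * b 1 x" "\<lambda>x. c 1 x - b 1 x / b 0 x * c 0 x" "\<lambda>_. 0"])
          (use b c0 cps u 1 in \<open>auto simp: carries_def less_2_cases_iff field_simps intro!: cps_intros\<close>)
    next
      assume u: u "\<not> w"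
      \<comment> \<open>A shear clears \<open>b 1\<close>; the parameter is a multiple of the product of \<open>c\<close> and \<open>b\<close>.\<close>
      show thesis
        by (rule result[of "\<lambda>_. 1" "\<lambda>_. 0" "\<lambda>x. - (b 1 x / b 0 x)" "\<lambda>_. 1"
              "b 0" "\<lambda>x. 1 / c 1 x" "\<lambda>x. c 0 x / c 1 x + b 1 x / b 0 x"])
          (use b c0 cps u 1 in \<open>auto simp: carries_def less_2_cases_iff field_simps intro!: cps_intros\<close>)
    next
      assume u: "\<not> u" w
      \<comment> \<open>The same with row and column exchanged.\<close>
      show thesis
        by (rule result[of "\<lambda>_. 1" "\<lambda>x. b 1 x / b 0 x" "\<lambda>_. 0" "\<lambda>_. 1"
              "\<lambda>x. 1 / b 0 x" "c 1" "\<lambda>x. c 0 x / c 1 x + b 1 x / b 0 x"])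
          (use b c0 cps u 1 in \<open>auto simp: carries_def less_2_cases_iff field_simps intro!: cps_intros\<close>)
    next
      assume u: "\<not> u" "\<not> w"
      \<comment> \<open>Two independent rows are the rows of \<open>G\<close>.\<close>
      show thesis
        by (rule result[of "b 0" "b 1" "c 0" "c 1" "\<lambda>_. 1" "\<lambda>_. 1" "\<lambda>_. 0"])
          (use b c0 cps u 1 in \<open>auto simp: carries_def less_2_cases_iff field_simps intro!: cps_intros\<close>)
    qed
  next
    case 2
    note c0 = c(2,3)[unfolded 2, simplified]
    show thesis
    proof (cases u; cases w)
      assume u: u w
      \<comment> \<open>A shear clears \<open>b 1\<close>; the parameter is the difference of the two slopes.\<close>
      show thesis
        by (rule result[of "\<lambda>_. 1" "\<lambda>_. 0" "\<lambda>x. - (b 1 x / b 0 x)" "\<lambda>_. 1"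
              "b 0" "c 0" "\<lambda>x. c 1 x / c 0 x - b 1 x / b 0 x"])
          (use b c0 cps u 2 in \<open>auto simp: carries_def less_2_cases_iff field_simps intro!: cps_intros\<close>)
    next
      assume u: u "\<not> w"
      \<comment> \<open>The first row of \<open>G\<close> is \<open>c\<close> and the second one annihilates \<open>b\<close>.\<close>
      show thesis
        by (rule result[of "c 0" "c 1" "\<lambda>x. - b 1 x" "b 0"
              "\<lambda>x. c 0 x * b 0 x + c 1 x * b 1 x" "\<lambda>_. 1" "\<lambda>_. 0"])
          (use b c0 cps u 2 in \<open>auto simp: carries_def less_2_cases_iff field_simps intro!: cps_intros\<close>)
    next
      assume u: "\<not> u" w
      \<comment> \<open>The first row of \<open>G\<close> is \<open>b\<close> and the second one annihilates \<open>c\<close>.\<close>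
      show thesis
        by (rule result[of "b 0" "b 1" "\<lambda>x. - c 1 x" "c 0"
              "\<lambda>_. 1" "\<lambda>x. b 0 x * c 0 x + b 1 x * c 1 x" "\<lambda>_. 0"])
          (use b c0 cps u 2 in \<open>auto simp: carries_def less_2_cases_iff field_simps intro!: cps_intros\<close>)
    next
      assume u: "\<not> u" "\<not> w"
      \<comment> \<open>The same shear for rows.\<close>
      show thesis
        by (rule result[of "\<lambda>_. 1" "\<lambda>x. b 1 x / b 0 x" "\<lambda>_. 0" "\<lambda>_. 1"
              "\<lambda>x. 1 / b 0 x" "\<lambda>x. 1 / c 0 x" "\<lambda>x. c 1 x / c 0 x - b 1 x / b 0 x"])
          (use b c0 cps u 2 in \<open>auto simp: carries_def less_2_cases_iff field_simps intro!: cps_intros\<close>)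
    qed
  qed
qed

text \<open>Conversely the surviving parameter cannot be removed, because the degeneracy of the two vectors
  does not depend on the bases.\<close>

lemma plane_parameter_invariant:
  fixes G :: "nat \<Rightarrow> nat \<Rightarrow> 'a::field"
  assumes "carries u G s\<^sub>1 (\<lambda>i. if i = 0 then 1 else 0) (\<lambda>i. if i = 0 then 1 else 0)"
    and "carries w G s\<^sub>2 (\<lambda>i. if i = e then 1 else a) (\<lambda>i. if i = e then 1 else 0)"
    and "if e = 0 then u = w else u \<noteq> w" "e < 2"
    and "s\<^sub>1 \<noteq> 0" "s\<^sub>2 \<noteq> 0" "G 1 1 \<noteq> 0"
  shows "a = 0"
  using assms
  by (cases u; cases w) (auto simp: carries_def less_2_cases_iff split: if_splits)

section \<open>One-parameter deformations along a matrix unit\<close>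

definition perturbed ::
  "('v, 'e) pre_digraph \<Rightarrow> ('v \<Rightarrow> nat) \<Rightarrow> ('e \<Rightarrow> 'a::comm_monoid_add mat) \<Rightarrow> 'e \<times> nat \<times> nat \<Rightarrow>
   'a \<Rightarrow> 'e \<Rightarrow> 'a mat" where
  "perturbed Q n A \<gamma> a \<alpha> = mat (n (head Q \<alpha>)) (n (tail Q \<alpha>))
     (\<lambda>(i, j). A \<alpha> $$ (i, j) + (if (\<alpha>, i, j) = \<gamma> then a else 0))"

lemma matrix_rep_perturbed: "matrix_rep Q n (perturbed Q n A \<gamma> a)"
  by (simp add: matrix_rep_def perturbed_def)

lemma perturbed_0:
  fixes A :: "'e \<Rightarrow> 'a::comm_monoid_add mat"
  assumes "matrix_rep Q n A" "\<alpha> \<in> arcs Q"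
  shows "perturbed Q n A \<gamma> 0 \<alpha> = A \<alpha>"
  using assms by (intro eq_matI) (auto simp: perturbed_def matrix_rep_def)

lemma perturbed_other_arrow:
  fixes A :: "'e \<Rightarrow> 'a::comm_monoid_add mat"
  assumes "matrix_rep Q n A" "\<alpha> \<in> arcs Q" "\<alpha> \<noteq> \<beta>"
  shows "perturbed Q n A (\<beta>, ij) a \<alpha> = A \<alpha>"
  using assms by (cases ij, intro eq_matI) (auto simp: perturbed_def matrix_rep_def)

lemma deformation_perturbed:
  fixes A :: "'e \<Rightarrow> 'a::{real_normed_field,banach} mat"
  assumes "matrix_rep Q n A"
  shows "deformation Q n 1 A (\<lambda>x. perturbed Q n A \<gamma> (x 0))"
  unfolding deformation_iff
proof (intro ballI conjI)
  fix \<alpha> assume \<alpha>: "\<alpha> \<in> arcs Q"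
  have "convergent_power_series 1 (\<lambda>x. a + (if P then x 0 else 0) :: 'a)" for a P
    by (cases P) (auto intro: cps_intros)
  then show "cps_mat 1 (n (head Q \<alpha>)) (n (tail Q \<alpha>)) (\<lambda>x. perturbed Q n A \<gamma> (x 0) \<alpha>)"
    by (simp add: cps_mat_def perturbed_def)
  show "perturbed Q n A \<gamma> 0 \<alpha> = A \<alpha>"
    by (rule perturbed_0[OF assms \<alpha>])
qed

lemma equivalent_deformations_cong:
  assumes "\<And>x \<alpha>. \<alpha> \<in> arcs Q \<Longrightarrow> D x \<alpha> = D' x \<alpha>" "\<And>x \<alpha>. \<alpha> \<in> arcs Q \<Longrightarrow> E x \<alpha> = E' x \<alpha>"
  shows "equivalent_deformations Q n k D E \<longleftrightarrow> equivalent_deformations Q n k D' E'"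
  unfolding equivalent_deformations_def using assms by (simp cong: ball_cong)

lemma deformation_cong:
  assumes "\<And>x \<alpha>. \<alpha> \<in> arcs Q \<Longrightarrow> D x \<alpha> = D' x \<alpha>"
  shows "deformation Q n k A D \<longleftrightarrow> deformation Q n k A D'"
  unfolding deformation_iff using assms by (simp cong: ball_cong)

lemma cps_no_variables:
  fixes f :: "(nat \<Rightarrow> 'a::real_normed_field) \<Rightarrow> 'a"
  assumes "convergent_power_series 0 f"
  shows "f x = f y"
proof -
  obtain c where "\<And>x. ((\<lambda>m. c m) has_sum f x) {m :: nat \<Rightarrow> nat. \<forall>i. m i = 0}"
    using assms by (auto simp: convergent_power_series_def)
  then show ?thesis using has_sum_unique by blast
qed

lemma deformation_no_parameters:
  fixes D :: "(nat \<Rightarrow> 'a::real_normed_field) \<Rightarrow> 'e \<Rightarrow> 'a mat"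
  assumes D: "deformation Q n 0 A D" and \<alpha>: "\<alpha> \<in> arcs Q"
  shows "D x \<alpha> = A \<alpha>"
proof -
  have "D x \<alpha> = D (\<lambda>_. 0) \<alpha>"
  proof (rule eq_matI)
    fix i j assume "i < dim_row (D (\<lambda>_. 0) \<alpha>)" "j < dim_col (D (\<lambda>_. 0) \<alpha>)"
    then have "convergent_power_series 0 (\<lambda>x. D x \<alpha> $$ (i, j))"
      using D \<alpha> deformation_carrier[OF D \<alpha>, of "\<lambda>_. 0"] by (auto simp: deformation_def)
    then show "D x \<alpha> $$ (i, j) = D (\<lambda>_. 0) \<alpha> $$ (i, j)"
      by (rule cps_no_variables)
  qed (use deformation_carrier[OF D \<alpha>] in \<open>metis carrier_matD\<close>)+
  then show ?thesis using D \<alpha> by (simp add: deformation_iff)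
qed

lemma deformation_const:
  fixes A :: "'e \<Rightarrow> 'a::{real_normed_field,banach} mat"
  assumes "matrix_rep Q n A"
  shows "deformation Q n k A (\<lambda>_. A)"
  using assms by (auto simp: deformation_iff matrix_rep_def cps_mat_def intro: cps_intros)

lemma simplest_miniversal_0:
  fixes A :: "'e \<Rightarrow> 'a::{real_normed_field,banach} mat"
  assumes A: "matrix_rep Q n A"
    and rigid: "\<And>l B. deformation Q n l A B \<Longrightarrow> equivalent_deformations Q n l B (\<lambda>_. A)"
  shows "simplest_miniversal Q n 0 A (\<lambda>_. A)"
    and "miniversal Q n k A D \<Longrightarrow> k = 0 \<and> (\<forall>x. \<forall>\<alpha>\<in>arcs Q. D x \<alpha> = A \<alpha>)"
proof -
  have v: "versal Q n 0 A (\<lambda>_. A)"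
    using deformation_const[OF A] rigid by (simp add: versal_def)
  then show "simplest_miniversal Q n 0 A (\<lambda>_. A)"
    unfolding simplest_miniversal_def miniversal_def
    by (auto simp: bij_betw_def intro!: exI[of _ "{}"])
  show "k = 0 \<and> (\<forall>x. \<forall>\<alpha>\<in>arcs Q. D x \<alpha> = A \<alpha>)" if m: "miniversal Q n k A D"
  proof -
    have "k = 0" using m v by (auto simp: miniversal_def)
    moreover from this have "deformation Q n 0 A D"
      using m by (auto simp: miniversal_def versal_def)
    ultimately show ?thesis using deformation_no_parameters[of Q n A D] by auto
  qed
qed

text \<open>A deformation without parameters is constant. So the family along the matrix unit shows that one
  parameter is necessary as soon as it is not itself equivalent to the constant family.\<close>

lemma simplest_miniversal_1:
  fixes A :: "'e \<Rightarrow> 'a::{real_normed_field,banach} mat"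
  assumes A: "matrix_rep Q n A"
    and \<gamma>: "\<gamma> = (\<beta>, i, j)" "\<beta> \<in> arcs Q" "i < n (head Q \<beta>)" "j < n (tail Q \<beta>)"
    and reduce: "\<And>l B. deformation Q n l A B \<Longrightarrow> \<exists>\<phi>. convergent_power_series l \<phi> \<and> \<phi> (\<lambda>_. 0) = 0 \<and>
        equivalent_deformations Q n l B (\<lambda>\<mu>. perturbed Q n A \<gamma> (\<phi> \<mu>))"
    and nontrivial: "\<not> equivalent_deformations Q n 1 (\<lambda>x. perturbed Q n A \<gamma> (x 0)) (\<lambda>_. A)"
    and D: "\<And>x \<alpha>. \<alpha> \<in> arcs Q \<Longrightarrow> D x \<alpha> = perturbed Q n A \<gamma> (x 0) \<alpha>"
  shows "simplest_miniversal Q n 1 A D"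
proof -
  have "versal Q n 1 A D"
    unfolding versal_def
  proof (intro conjI allI impI)
    show "deformation Q n 1 A D"
      using deformation_perturbed[OF A, of \<gamma>] D by (subst deformation_cong) auto
    fix l B assume "deformation Q n l A B"
    then obtain \<phi> where \<phi>: "convergent_power_series l \<phi>" "\<phi> (\<lambda>_. 0) = 0"
      and "equivalent_deformations Q n l B (\<lambda>\<mu>. perturbed Q n A \<gamma> (\<phi> \<mu>))"
      using reduce by blast
    then have "equivalent_deformations Q n l B (\<lambda>\<mu>. D (\<lambda>i. \<phi> \<mu>))"
      using D by (subst equivalent_deformations_cong[OF refl]) auto
    with \<phi> show "\<exists>\<phi>. (\<forall>i<1. convergent_power_series l (\<phi> i) \<and> \<phi> i (\<lambda>_. 0) = 0) \<and>
        equivalent_deformations Q n l B (\<lambda>\<mu>. D (\<lambda>i. \<phi> i \<mu>))"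
      by (intro exI[of _ "\<lambda>_. \<phi>"]) auto
  qed
  moreover have "1 \<le> l" if v: "versal Q n l A D'" for l D'
  proof (rule ccontr)
    assume "\<not> 1 \<le> l"
    then have l: "l = 0" by simp
    then have const: "D' x \<alpha> = A \<alpha>" if "\<alpha> \<in> arcs Q" for x \<alpha>
      using v that by (auto simp: versal_def intro: deformation_no_parameters)
    obtain \<phi> where "equivalent_deformations Q n 1 (\<lambda>x. perturbed Q n A \<gamma> (x 0)) (\<lambda>\<mu>. D' (\<lambda>i. \<phi> i \<mu>))"
      using v deformation_perturbed[OF A, of \<gamma>] unfolding versal_def by blast
    then have "equivalent_deformations Q n 1 (\<lambda>x. perturbed Q n A \<gamma> (x 0)) (\<lambda>_. A)"
      using const by (subst equivalent_deformations_cong[OF refl]) auto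
    with nontrivial show False ..
  qed
  moreover have "\<exists>\<Gamma> e. \<Gamma> \<subseteq> {(\<alpha>, i, j). \<alpha> \<in> arcs Q \<and> i < n (head Q \<alpha>) \<and> j < n (tail Q \<alpha>)} \<and>
        bij_betw e \<Gamma> {..<1} \<and>
        (\<forall>x. \<forall>\<beta>\<in>arcs Q. \<forall>i<n (head Q \<beta>). \<forall>j<n (tail Q \<beta>).
           D x \<beta> $$ (i, j) =
             A \<beta> $$ (i, j) + (\<Sum>\<gamma>\<in>\<Gamma>. x (e \<gamma>) * elementary_rep Q n \<gamma> \<beta> $$ (i, j)))"
  proof (rule exI[of _ "{\<gamma>}"], rule exI[of _ "\<lambda>_. 0"], intro conjI)
    show "bij_betw (\<lambda>_. 0) {\<gamma>} {..<1::nat}"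
      by (auto simp: bij_betw_def)
    show "\<forall>x. \<forall>\<beta>\<in>arcs Q. \<forall>i<n (head Q \<beta>). \<forall>j<n (tail Q \<beta>). D x \<beta> $$ (i, j) =
        A \<beta> $$ (i, j) + (\<Sum>\<gamma>\<in>{\<gamma>}. x 0 * elementary_rep Q n \<gamma> \<beta> $$ (i, j))"
      by (auto simp: D perturbed_def elementary_rep_def \<gamma>(1))
  qed (use \<gamma> in auto)
  ultimately show ?thesis
    unfolding simplest_miniversal_def miniversal_def by blast
qed

section \<open>Sums of two interval representations\<close>

lemma mat_of_rows_list_small:
  shows "M \<in> carrier_mat 1 1 \<Longrightarrow> M = mat_of_rows_list 1 [[M $$ (0, 0)]]"
    and "M \<in> carrier_mat 2 1 \<Longrightarrow> M = mat_of_rows_list 1 [[M $$ (0, 0)], [M $$ (1, 0)]]"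
    and "M \<in> carrier_mat 1 2 \<Longrightarrow> M = mat_of_rows_list 2 [[M $$ (0, 0), M $$ (0, 1)]]"
  by (intro eq_matI; auto simp: mat_of_rows_list_def less_Suc_eq numeral_2_eq_2)+

locale interval_pair =
  fixes fwd :: "nat \<Rightarrow> bool" and t p q r s :: nat
    and Q :: "(nat, nat) pre_digraph" and n :: "nat \<Rightarrow> nat"
    and A :: "nat \<Rightarrow> 'a::{real_normed_field,banach} mat"
  assumes bounds: "1 \<le> p" "p \<le> q" "q \<le> t" "p \<le> r" "r \<le> s" "s \<le> t"
    and Q_def: "Q = chain_quiver t fwd"
    and n_def: "n = (\<lambda>v. L_dim p q v + L_dim r s v)"
    and A_def: "A = rep_sum (L_rep Q p q) (L_rep Q r s)"
begin

lemma Q_simps [simp]: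
  "verts Q = {1..t}" "arcs Q = {1..<t}"
  "tail Q \<alpha> = (if fwd \<alpha> then \<alpha> else \<alpha> + 1)" "head Q \<alpha> = (if fwd \<alpha> then \<alpha> + 1 else \<alpha>)"
  by (simp_all add: Q_def)

lemma fin_Q: "fin_digraph Q"
  by (simp add: Q_def fin_digraph_chain_quiver)

lemma wf_Q: "wf_digraph Q"
  using fin_Q by (simp add: fin_digraph_def)

lemma L_rep_carrier: "L_rep Q i j \<alpha> \<in> carrier_mat (L_dim i j (head Q \<alpha>)) (L_dim i j (tail Q \<alpha>))"
  by (simp add: L_rep_def L_dim_def)

lemma L_rep_entry:
  assumes "a < L_dim i j (head Q \<alpha>)" "b < L_dim i j (tail Q \<alpha>)"
  shows "(L_rep Q i j \<alpha> :: 'a mat) $$ (a, b) = 1"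
  using assms by (simp add: L_rep_def L_dim_def del: Q_simps split: if_splits)

lemma A_eq:
  "A \<alpha> = four_block_mat (L_rep Q p q \<alpha>) (0\<^sub>m (L_dim p q (head Q \<alpha>)) (L_dim r s (tail Q \<alpha>)))
     (0\<^sub>m (L_dim r s (head Q \<alpha>)) (L_dim p q (tail Q \<alpha>))) (L_rep Q r s \<alpha>)"
proof -
  have d: "dim_row (L_rep Q i j \<alpha> :: 'a mat) = L_dim i j (head Q \<alpha>)"
    "dim_col (L_rep Q i j \<alpha> :: 'a mat) = L_dim i j (tail Q \<alpha>)" for i j
    using L_rep_carrier[of i j \<alpha>] by (metis carrier_matD(1), metis carrier_matD(2))
  have "four_block_mat (L_rep Q r s \<alpha>) (0\<^sub>m (L_dim r s (head Q \<alpha>)) 0)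
      (0\<^sub>m 0 (L_dim r s (tail Q \<alpha>))) (0\<^sub>m 0 0) = (L_rep Q r s \<alpha> :: 'a mat)"
    by (intro eq_matI) (auto simp: d simp del: Q_simps)
  then show ?thesis
    by (simp add: A_def rep_sum_def Let_def d del: Q_simps)
qed

lemma A_carrier: "A \<alpha> \<in> carrier_mat (n (head Q \<alpha>)) (n (tail Q \<alpha>))"
  unfolding n_def A_eq by (intro four_block_carrier_mat L_rep_carrier)

lemma A_rep: "matrix_rep Q n A"
  by (simp add: matrix_rep_def A_carrier del: Q_simps)

text \<open>A block of an interval representation has an entry only if the interval contains both ends of
  the arrow, and this entry is \<open>1\<close>.\<close>

lemma A_entry:
  assumes "i < n (head Q \<alpha>)" "j < n (tail Q \<alpha>)"
  shows "A \<alpha> $$ (i, j) = (if i < L_dim p q (head Q \<alpha>) \<longleftrightarrow> j < L_dim p q (tail Q \<alpha>) then 1 else 0)"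
proof -
  have d: "dim_row (L_rep Q i j \<alpha> :: 'a mat) = L_dim i j (head Q \<alpha>)"
    "dim_col (L_rep Q i j \<alpha> :: 'a mat) = L_dim i j (tail Q \<alpha>)" for i j
    using L_rep_carrier[of i j \<alpha>] by (metis carrier_matD(1), metis carrier_matD(2))
  show ?thesis
    unfolding A_eq using assms
    by (auto simp: d n_def L_rep_entry simp del: Q_simps)
qed

lemma A_flat:
  assumes "L_dim p q (\<alpha> + 1) = L_dim p q \<alpha>" "L_dim r s (\<alpha> + 1) = L_dim r s \<alpha>" "\<alpha> \<in> {1..<t}"
  shows "A \<alpha> = 1\<^sub>m (n \<alpha>)"
proof -
  have n: "n (head Q \<alpha>) = n \<alpha>" "n (tail Q \<alpha>) = n \<alpha>"
    "L_dim p q (head Q \<alpha>) = L_dim p q \<alpha>" "L_dim p q (tail Q \<alpha>) = L_dim p q \<alpha>"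
    using assms by (auto simp: n_def)
  have c: "A \<alpha> \<in> carrier_mat (n \<alpha>) (n \<alpha>)"
    using A_carrier[of \<alpha>] unfolding n .
  show ?thesis
  proof (rule eq_matI)
    fix i j assume "i < dim_row (1\<^sub>m (n \<alpha>) :: 'a mat)" "j < dim_col (1\<^sub>m (n \<alpha>) :: 'a mat)"
    then have ij: "i < n \<alpha>" "j < n \<alpha>" by auto
    then have "i < L_dim p q \<alpha> \<longleftrightarrow> j < L_dim p q \<alpha> \<longleftrightarrow> i = j"
      by (auto simp: n_def L_dim_def split: if_splits)
    then show "A \<alpha> $$ (i, j) = 1\<^sub>m (n \<alpha>) $$ (i, j)"
      using ij A_entry[of i \<alpha> j] n by auto
  qed (use c in auto)
qed

text \<open>After straightening, information remains only on the arrows where one of the two intervals begins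
  or ends.\<close>

lemma straightened:
  assumes "deformation Q n l A B"
  obtains S E where "deformation Q n l A E" "intertwines Q n l S B E"
    "\<And>\<alpha> x. \<alpha> \<in> {1..<t} \<Longrightarrow> L_dim p q (\<alpha> + 1) = L_dim p q \<alpha> \<Longrightarrow> L_dim r s (\<alpha> + 1) = L_dim r s \<alpha> \<Longrightarrow>
       E x \<alpha> = 1\<^sub>m (n \<alpha>)"
proof (rule chain_straightening[OF assms[unfolded Q_def] A_rep[unfolded Q_def], folded Q_def])
  fix S E
  assume "deformation Q n l A E" "intertwines Q n l S B E"
    and "\<And>\<alpha> x. \<alpha> \<in> {1..<t} \<Longrightarrow> n (\<alpha> + 1) = n \<alpha> \<Longrightarrow> A \<alpha> = 1\<^sub>m (n \<alpha>) \<Longrightarrow> E x \<alpha> = 1\<^sub>m (n \<alpha>)"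
  then show thesis
    using that[of E S] A_flat by (simp add: n_def)
qed

lemma rep_if_deformation: "deformation Q n l A B \<Longrightarrow> matrix_rep Q n (B x)"
  by (simp add: deformation_def)

subsection \<open>Disjoint intervals\<close>

text \<open>No vertex has dimension \<open>2\<close>, so every matrix has at most one entry; the only entry that
  straightening leaves is the one on an arrow that joins the two intervals.\<close>

lemma reduce_disjoint:
  assumes rq: "q < r" and B: "deformation Q n l A B"
  shows "\<exists>\<phi>. convergent_power_series l \<phi> \<and> \<phi> (\<lambda>_. 0) = 0 \<and>
    (\<not> adjacent_pair p q r s \<longrightarrow> \<phi> = (\<lambda>_. 0)) \<and>
    equivalent_deformations Q n l B (\<lambda>\<mu>. perturbed Q n A (q, 0, 0) (\<phi> \<mu>))"
proof -
  obtain S E where E: "deformation Q n l A E" "intertwines Q n l S B E" and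
    flat: "\<And>\<alpha> x. \<alpha> \<in> {1..<t} \<Longrightarrow> L_dim p q (\<alpha> + 1) = L_dim p q \<alpha> \<Longrightarrow>
      L_dim r s (\<alpha> + 1) = L_dim r s \<alpha> \<Longrightarrow> E x \<alpha> = 1\<^sub>m (n \<alpha>)"
    by (rule straightened[OF B]) (rule that; assumption)
  define \<phi> where "\<phi> \<mu> = (if r = q + 1 then E \<mu> q $$ (0, 0) else 0)" for \<mu>
  have adj: "adjacent_pair p q r s \<longleftrightarrow> r = q + 1"
    using bounds by (auto simp: adjacent_pair_def)
  have q: "q \<in> {1..<t}" "n q = 1" "n (q + 1) = 1" if "r = q + 1"
    using that bounds by (auto simp: n_def L_dim_def)
  have cps: "convergent_power_series l \<phi> \<and> \<phi> (\<lambda>_. 0) = 0"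
  proof (cases "r = q + 1")
    case True
    have "A q $$ (0, 0) = 0"
      using q[OF True] bounds True by (subst A_entry) (auto simp: L_dim_def)
    moreover have "\<phi> = (\<lambda>\<mu>. E \<mu> q $$ (0, 0))"
      using True by (simp add: \<phi>_def fun_eq_iff)
    ultimately show ?thesis
      using E(1) q[OF True] by (auto simp: deformation_def split: if_splits)
  next
    case False
    then have "\<phi> = (\<lambda>_. 0)" by (simp add: \<phi>_def fun_eq_iff)
    then show ?thesis by (simp add: cps_const)
  qed
  have eq: "E x \<alpha> = perturbed Q n A (q, 0, 0) (\<phi> x) \<alpha>" if \<alpha>: "\<alpha> \<in> {1..<t}" for x \<alpha>
  proof -
    have cE: "E x \<alpha> \<in> carrier_mat (n (head Q \<alpha>)) (n (tail Q \<alpha>))"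
      using deformation_carrier[OF E(1)] \<alpha> by simp
    have cA: "A \<alpha> \<in> carrier_mat (n (head Q \<alpha>)) (n (tail Q \<alpha>))"
      using A_rep \<alpha> by (simp add: matrix_rep_def)
    have "n \<alpha> = 0 \<or> n (\<alpha> + 1) = 0 \<or> \<alpha> = q \<and> r = q + 1 \<or>
        L_dim p q (\<alpha> + 1) = L_dim p q \<alpha> \<and> L_dim r s (\<alpha> + 1) = L_dim r s \<alpha> \<and> \<alpha> \<noteq> q"
      using rq bounds by (auto simp: n_def L_dim_def)
    then consider "n \<alpha> = 0 \<or> n (\<alpha> + 1) = 0" | "\<alpha> = q" "r = q + 1"
      | "L_dim p q (\<alpha> + 1) = L_dim p q \<alpha>" "L_dim r s (\<alpha> + 1) = L_dim r s \<alpha>" "\<alpha> \<noteq> q"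
      by metis
    then show ?thesis
    proof cases
      case 1
      then show ?thesis
        using cE by (intro eq_matI) (auto simp: perturbed_def split: if_splits)
    next
      case 2
      have "A q $$ (0, 0) = 0"
        using q 2 bounds by (subst A_entry) (auto simp: L_dim_def)
      then show ?thesis
        using cE 2 q by (intro eq_matI) (auto simp: perturbed_def \<phi>_def split: if_splits)
    next
      case 3
      then have "E x \<alpha> = A \<alpha>"
        using flat A_flat \<alpha> by simp
      then show ?thesis
        using cA 3(3) by (intro eq_matI) (auto simp: perturbed_def)
    qed
  qed
  have "equivalent_deformations Q n l B E"
    using intertwines_imp_equivalent[OF fin_Q rep_if_deformation[OF E(1)] E(2)] .
  then have "equivalent_deformations Q n l B (\<lambda>\<mu>. perturbed Q n A (q, 0, 0) (\<phi> \<mu>))"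
    using eq by (subst equivalent_deformations_cong[where D' = B and E' = E]) auto
  then show ?thesis
    using cps adj by (intro exI[of _ \<phi>]) (auto simp: \<phi>_def)
qed

lemma adjacent_nontrivial:
  assumes "adjacent_pair p q r s"
  shows "\<not> equivalent_deformations Q n 1 (\<lambda>x. perturbed Q n A (q, 0, 0) (x 0)) (\<lambda>_. A)"
proof
  assume "equivalent_deformations Q n 1 (\<lambda>x. perturbed Q n A (q, 0, 0) (x 0)) (\<lambda>_. A)"
  then obtain S where S: "intertwines Q n 1 S (\<lambda>x. perturbed Q n A (q, 0, 0) (x 0)) (\<lambda>_. A)"
    using equivalent_imp_intertwines[OF wf_Q deformation_perturbed[OF A_rep]] by blast
  have q: "q \<in> {1..<t}" "n q = 1" "n (q + 1) = 1"
    using assms bounds by (auto simp: n_def L_dim_def adjacent_pair_def)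
  have hd: "head Q q \<in> verts Q" "n (head Q q) = 1" "n (tail Q q) = 1" "tail Q q \<in> verts Q"
    using q by auto
  have A0: "A q $$ (0, 0) = 0"
    using q assms bounds by (subst A_entry) (auto simp: L_dim_def adjacent_pair_def)
  have nid: "near_identity 1 1 (S (head Q q))" "near_identity 1 1 (S (tail Q q))"
    using S hd unfolding intertwines_def by force+
  have "\<forall>\<^sub>F x in near_zero 1. S (head Q q) x $$ (0, 0) \<noteq> 0"
    using nid by (intro cps_eventually_nonzero) (auto simp: near_identity_def cps_mat_def)
  moreover have "\<forall>\<^sub>F x in near_zero 1. \<forall>\<alpha>\<in>arcs Q.
      A \<alpha> * S (tail Q \<alpha>) x = S (head Q \<alpha>) x * perturbed Q n A (q, 0, 0) (x 0) \<alpha>"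
    using S unfolding intertwines_def by (rule conjunct2)
  ultimately have "\<forall>\<^sub>F x in near_zero 1. S (head Q q) x $$ (0, 0) \<noteq> 0 \<and> (\<forall>\<alpha>\<in>arcs Q.
      A \<alpha> * S (tail Q \<alpha>) x = S (head Q \<alpha>) x * perturbed Q n A (q, 0, 0) (x 0) \<alpha>)"
    by (rule eventually_conj)
  then obtain x where x: "S (head Q q) x $$ (0, 0) \<noteq> 0" "x 0 \<noteq> 0"
    "\<forall>\<alpha>\<in>arcs Q. A \<alpha> * S (tail Q \<alpha>) x = S (head Q \<alpha>) x * perturbed Q n A (q, 0, 0) (x 0) \<alpha>"
    by (rule eventually_near_zero_nonzero_witness) blast
  have c: "A q \<in> carrier_mat 1 1" "S (head Q q) x \<in> carrier_mat 1 1" "S (tail Q q) x \<in> carrier_mat 1 1"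
    using A_carrier[of q] near_identity_carrier[OF nid(1)] near_identity_carrier[OF nid(2)]
    unfolding hd by simp_all
  have "A q * S (tail Q q) x = S (head Q q) x * perturbed Q n A (q, 0, 0) (x 0) q"
    using x(3) q by (simp del: Q_simps(3,4))
  then have "(A q * S (tail Q q) x) $$ (0, 0)
      = (S (head Q q) x * perturbed Q n A (q, 0, 0) (x 0) q) $$ (0, 0)"
    by simp
  then have "S (head Q q) x $$ (0, 0) * x 0 = 0"
    using c A0 hd by (simp add: perturbed_def scalar_prod_def del: Q_simps(3,4))
  with x show False by simp
qed

subsection \<open>Overlapping intervals\<close>

text \<open>The overlap is \<open>{r..overlap_end}\<close>. The summand with index \<open>right_summand\<close> is the one whose interval
  extends beyond its right end, provided that \<open>q \<noteq> s\<close>. The matrix on the arrow there has its entry \<open>1\<close>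
  at this index, and the parameter sits at the other one.\<close>

definition overlap_end :: nat where "overlap_end = min q s"

definition right_summand :: nat where "right_summand = (if q < s then 1 else 0)"

definition parameter_place :: "nat \<times> nat \<times> nat" where
  "parameter_place = (overlap_end, if fwd overlap_end then (0, 1 - right_summand) else (1 - right_summand, 0))"

definition exceptional_overlap :: bool where
  "exceptional_overlap \<longleftrightarrow> p < r \<and> q \<noteq> s \<and> (if right_summand = 0 then fwd (r - 1) \<noteq> fwd overlap_end else fwd (r - 1) = fwd overlap_end)"

lemma overlap_dims:
  assumes "r \<le> q"
  shows "r \<le> v \<Longrightarrow> v \<le> overlap_end \<Longrightarrow> n v = 2"
    and "p < r \<Longrightarrow> r - 1 \<in> {1..<t} \<and> n (r - 1) = 1"
    and "q \<noteq> s \<Longrightarrow> overlap_end \<in> {1..<t} \<and> n (overlap_end + 1) = 1"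
    and "r \<le> overlap_end"
  using assms bounds by (auto simp: n_def L_dim_def overlap_end_def)

lemma left_entry:
  assumes "r \<le> q" "p < r" "i < 2"
  shows "A (r - 1) $$ (if fwd (r - 1) then (i, 0) else (0, i)) = (if i = 0 then 1 else 0)"
  using assms bounds A_entry[of i "r - 1" 0] A_entry[of 0 "r - 1" i] overlap_dims[OF assms(1)]
  by (auto simp: L_dim_def)

lemma right_entry:
  assumes "r \<le> q" "q \<noteq> s" "i < 2"
  shows "A overlap_end $$ (if \<not> fwd overlap_end then (i, 0) else (0, i)) = (if i = right_summand then 1 else 0)"
proof -
  note dims = overlap_dims(1)[OF assms(1), of overlap_end] overlap_dims(3)[OF assms(1,2)] overlap_dims(4)[OF assms(1)]
  have L: "L_dim p q overlap_end = 1" "L_dim p q (overlap_end + 1) = 1 - right_summand"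
    using assms bounds by (auto simp: L_dim_def overlap_end_def right_summand_def)
  show ?thesis
  proof (cases "fwd overlap_end")
    case True
    then show ?thesis
      using A_entry[of 0 overlap_end i] dims L assms(3) by (auto simp: right_summand_def split: if_splits)
  next
    case False
    then show ?thesis
      using A_entry[of i overlap_end 0] dims L assms(3) by (auto simp: right_summand_def split: if_splits)
  qed
qed

lemma right_entry_perturbed:
  assumes "r \<le> q" "q \<noteq> s" "i < 2"
  shows "perturbed Q n A parameter_place a overlap_end $$ (if \<not> fwd overlap_end then (i, 0) else (0, i))
    = (if i = right_summand then 1 else a)"
proof -
  note dims = overlap_dims(1)[OF assms(1), of overlap_end] overlap_dims(3)[OF assms(1,2)] overlap_dims(4)[OF assms(1)]
  show ?thesis
  proof (cases "fwd overlap_end")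
    case True
    then have "n (head Q overlap_end) = 1" "n (tail Q overlap_end) = 2" using dims by auto
    then have "perturbed Q n A parameter_place a overlap_end $$ (0, i) = A overlap_end $$ (0, i) + (if i = 1 - right_summand then a else 0)"
      using assms(3) True by (simp add: perturbed_def parameter_place_def del: Q_simps)
    then show ?thesis
      using right_entry[OF assms] assms(3) True by (auto simp: right_summand_def)
  next
    case False
    then have "n (head Q overlap_end) = 2" "n (tail Q overlap_end) = 1" using dims by auto
    then have "perturbed Q n A parameter_place a overlap_end $$ (i, 0) = A overlap_end $$ (i, 0) + (if i = 1 - right_summand then a else 0)"
      using assms(3) False by (simp add: perturbed_def parameter_place_def del: Q_simps)
    then show ?thesis
      using right_entry[OF assms] assms(3) False by (auto simp: right_summand_def)
  qed
qed

lemma arrow_cases: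
  assumes "r \<le> q" "\<alpha> \<in> {1..<t}"
  obtains (left) "\<alpha> = r - 1" "p < r" | (right) "\<alpha> = overlap_end" "q \<noteq> s"
    | (empty) "n \<alpha> = 0 \<or> n (\<alpha> + 1) = 0"
    | (flat) "L_dim p q (\<alpha> + 1) = L_dim p q \<alpha>" "L_dim r s (\<alpha> + 1) = L_dim r s \<alpha>" "\<alpha> \<noteq> overlap_end"
        "r \<le> \<alpha> + 1 \<longleftrightarrow> r \<le> \<alpha>" "\<alpha> + 1 \<le> overlap_end \<longleftrightarrow> \<alpha> \<le> overlap_end"
proof -
  have "\<alpha> = r - 1 \<and> p < r \<or> \<alpha> = overlap_end \<and> q \<noteq> s \<or> n \<alpha> = 0 \<or> n (\<alpha> + 1) = 0 \<or>
      L_dim p q (\<alpha> + 1) = L_dim p q \<alpha> \<and> L_dim r s (\<alpha> + 1) = L_dim r s \<alpha> \<and> \<alpha> \<noteq> overlap_end \<and>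
      (r \<le> \<alpha> + 1 \<longleftrightarrow> r \<le> \<alpha>) \<and> (\<alpha> + 1 \<le> overlap_end \<longleftrightarrow> \<alpha> \<le> overlap_end)"
    using assms bounds by (auto simp: n_def L_dim_def overlap_end_def)
  then show thesis using that by blast
qed

text \<open>Basis changes that are constant on the overlap, to the left of it and to the right of it preserve
  the identity matrices obtained by straightening. What such changes achieve at the two ends of the
  overlap is the content of \<open>plane_normal_form\<close>.\<close>

lemma reduce_overlapping:
  assumes rq: "r \<le> q" and B: "deformation Q n l A B"
  shows "\<exists>\<phi>. convergent_power_series l \<phi> \<and> \<phi> (\<lambda>_. 0) = 0 \<and>
    (\<not> exceptional_overlap \<longrightarrow> \<phi> = (\<lambda>_. 0)) \<and>
    equivalent_deformations Q n l B (\<lambda>\<mu>. perturbed Q n A parameter_place (\<phi> \<mu>))"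
proof -
  obtain T E where E: "deformation Q n l A E" "intertwines Q n l T B E" and
    flat: "\<And>\<alpha> x. \<alpha> \<in> {1..<t} \<Longrightarrow> L_dim p q (\<alpha> + 1) = L_dim p q \<alpha> \<Longrightarrow>
      L_dim r s (\<alpha> + 1) = L_dim r s \<alpha> \<Longrightarrow> E x \<alpha> = 1\<^sub>m (n \<alpha>)"
    by (rule straightened[OF B]) (rule that; assumption)
  note dims = overlap_dims[OF rq]
  \<comment> \<open>If an end of the overlap has no arrow with a nonempty matrix, a constant vector is used instead, in
    the direction for which no parameter arises.\<close>
  define w where "w = (if q \<noteq> s then \<not> fwd overlap_end else \<not> fwd (r - 1))"
  define u where "u = (if p < r then fwd (r - 1) else if right_summand = 0 then \<not> w else w)"
  define b where "b i x = (if p < r then E x (r - 1) $$ (if u then (i, 0) else (0, i))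
    else if i = 0 then 1 else 0)" for i x
  define c where "c i x = (if q \<noteq> s then E x overlap_end $$ (if w then (i, 0) else (0, i))
    else if i = 0 then 1 else 0)" for i x
  have right_summand_less: "right_summand < 2" by (simp add: right_summand_def)
  have right_summand_eq_0: "right_summand = 0" if "q = s" unfolding right_summand_def using that by simp
  have exc: "(if right_summand = 0 then u = w else u \<noteq> w) \<longleftrightarrow> exceptional_overlap"
    using right_summand_eq_0 by (auto simp: exceptional_overlap_def u_def w_def)
  have b: "convergent_power_series l (b i)" "b i (\<lambda>_. 0) = (if i = 0 then 1 else 0)" if "i < 2" for i
  proof -
    have "convergent_power_series l (b i) \<and> b i (\<lambda>_. 0) = (if i = 0 then 1 else 0)"
    proof (cases "p < r")
      case True
      then have "r - 1 \<in> arcs Q" "n (head Q (r - 1)) = (if u then 2 else 1)"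
        "n (tail Q (r - 1)) = (if u then 1 else 2)" "E (\<lambda>_. 0) (r - 1) = A (r - 1)"
        using dims(1)[of r] dims(2,4) E(1) by (auto simp: u_def deformation_def)
      then have "convergent_power_series l (\<lambda>x. E x (r - 1) $$ (if u then (i, 0) else (0, i)))"
        "E (\<lambda>_. 0) (r - 1) $$ (if u then (i, 0) else (0, i)) = (if i = 0 then 1 else 0)"
        using E(1) that left_entry[OF rq True that] True
        by (auto simp: deformation_def u_def simp del: Q_simps)
      moreover have "b i = (\<lambda>x. E x (r - 1) $$ (if u then (i, 0) else (0, i)))"
        using True by (simp add: b_def fun_eq_iff)
      ultimately show ?thesis by simp
    next
      case False
      then have "b i = (\<lambda>_. if i = 0 then 1 else 0)" by (simp add: b_def fun_eq_iff)
      then show ?thesis by (simp add: cps_const)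
    qed
    then show "convergent_power_series l (b i)" "b i (\<lambda>_. 0) = (if i = 0 then 1 else 0)" by auto
  qed
  have c: "convergent_power_series l (c i)" "c i (\<lambda>_. 0) = (if i = right_summand then 1 else 0)" if "i < 2" for i
  proof -
    have "convergent_power_series l (c i) \<and> c i (\<lambda>_. 0) = (if i = right_summand then 1 else 0)"
    proof (cases "q \<noteq> s")
      case True
      then have "overlap_end \<in> arcs Q" "n (head Q overlap_end) = (if w then 2 else 1)"
        "n (tail Q overlap_end) = (if w then 1 else 2)" "E (\<lambda>_. 0) overlap_end = A overlap_end"
        using dims(1)[of overlap_end] dims(3,4) E(1) by (auto simp: w_def deformation_def)
      then have "convergent_power_series l (\<lambda>x. E x overlap_end $$ (if w then (i, 0) else (0, i)))"
        "E (\<lambda>_. 0) overlap_end $$ (if w then (i, 0) else (0, i)) = (if i = right_summand then 1 else 0)"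
        using E(1) that right_entry[OF rq True that] True
        by (auto simp: deformation_def w_def simp del: Q_simps)
      moreover have "c i = (\<lambda>x. E x overlap_end $$ (if w then (i, 0) else (0, i)))"
        using True by (simp add: c_def fun_eq_iff)
      ultimately show ?thesis by simp
    next
      case False
      then have "c i = (\<lambda>_. if i = 0 then 1 else 0)" by (simp add: c_def fun_eq_iff)
      moreover have "right_summand = 0"
        using False by (intro right_summand_eq_0) simp
      ultimately show ?thesis by (simp add: cps_const)
    qed
    then show "convergent_power_series l (c i)" "c i (\<lambda>_. 0) = (if i = right_summand then 1 else 0)" by auto
  qed
  have ce: "c right_summand (\<lambda>_. 0) = 1" "c (1 - right_summand) (\<lambda>_. 0) = 0"
    using c(2)[of right_summand] c(2)[of "1 - right_summand"] right_summand_less by (auto simp: right_summand_def split: if_splits)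
  have b0: "b 0 (\<lambda>_. 0) = 1" "b 1 (\<lambda>_. 0) = 0" using b by auto
  obtain G s\<^sub>1 s\<^sub>2 \<phi> where
    G: "\<And>i j. i < 2 \<Longrightarrow> j < 2 \<Longrightarrow> convergent_power_series l (G i j)"
      "\<And>i j. i < 2 \<Longrightarrow> j < 2 \<Longrightarrow> G i j (\<lambda>_. 0) = (if i = j then 1 else 0)" and
    s: "convergent_power_series l s\<^sub>1" "s\<^sub>1 (\<lambda>_. 0) = 1"
      "convergent_power_series l s\<^sub>2" "s\<^sub>2 (\<lambda>_. 0) = 1" and
    \<phi>: "convergent_power_series l \<phi>" "\<phi> (\<lambda>_. 0) = 0" "\<not> exceptional_overlap \<Longrightarrow> \<phi> = (\<lambda>_. 0)" and
    ev: "\<forall>\<^sub>F x in near_zero l.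
       carries u (\<lambda>i j. G i j x) (s\<^sub>1 x) (\<lambda>i. b i x) (\<lambda>i. if i = 0 then 1 else 0) \<and>
       carries w (\<lambda>i j. G i j x) (s\<^sub>2 x) (\<lambda>i. c i x) (\<lambda>i. if i = right_summand then 1 else \<phi> x)"
    using plane_normal_form[OF b(1) b0 c(1) ce right_summand_less, where u = u and w = w] unfolding exc by blast
  define S where "S v x = mat (n v) (n v) (\<lambda>(i, j).
    if r \<le> v \<and> v \<le> overlap_end then G i j x else if v < r then s\<^sub>1 x else s\<^sub>2 x)" for v x
  have n_le: "n v \<le> 2" "\<not> (r \<le> v \<and> v \<le> overlap_end) \<Longrightarrow> n v \<le> 1" for v
    using rq bounds by (auto simp: n_def L_dim_def overlap_end_def)
  have nid: "near_identity l (n v) (S v)" for v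
  proof (cases "r \<le> v \<and> v \<le> overlap_end")
    case True
    then show ?thesis
      using G dims(1)[of v] by (auto simp: near_identity_def cps_mat_def S_def intro!: eq_matI)
  next
    case False
    then show ?thesis
      using s n_le(2)[OF False] by (auto simp: near_identity_def cps_mat_def S_def intro!: eq_matI)
  qed
  have "\<forall>\<^sub>F x in near_zero l. \<forall>\<alpha>\<in>arcs Q.
      perturbed Q n A parameter_place (\<phi> x) \<alpha> * S (tail Q \<alpha>) x = S (head Q \<alpha>) x * E x \<alpha>"
    using ev
  proof (eventually_elim, intro ballI)
    fix x \<alpha>
    assume x: "carries u (\<lambda>i j. G i j x) (s\<^sub>1 x) (\<lambda>i. b i x) (\<lambda>i. if i = 0 then 1 else 0) \<and>
       carries w (\<lambda>i j. G i j x) (s\<^sub>2 x) (\<lambda>i. c i x) (\<lambda>i. if i = right_summand then 1 else \<phi> x)"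
      and "\<alpha> \<in> arcs Q"
    then have \<alpha>: "\<alpha> \<in> {1..<t}" by simp
    let ?P = "perturbed Q n A parameter_place (\<phi> x) \<alpha>"
    have cP: "?P \<in> carrier_mat (n (head Q \<alpha>)) (n (tail Q \<alpha>))"
      by (simp add: perturbed_def)
    have cE: "E x \<alpha> \<in> carrier_mat (n (head Q \<alpha>)) (n (tail Q \<alpha>))"
      using deformation_carrier[OF E(1)] \<alpha> by simp
    have cS: "S v x \<in> carrier_mat (n v) (n v)" for v
      by (simp add: S_def)
    show "?P * S (tail Q \<alpha>) x = S (head Q \<alpha>) x * E x \<alpha>"
      using rq \<alpha>
    proof (cases rule: arrow_cases)
      case left
      have SG: "S r x \<in> carrier_mat 2 2" "S (r - 1) x \<in> carrier_mat 1 1"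
        and vals: "i < 2 \<Longrightarrow> j < 2 \<Longrightarrow> S r x $$ (i, j) = G i j x" "S (r - 1) x $$ (0, 0) = s\<^sub>1 x" for i j
        using dims(1)[of r] dims(2,4) left(2) by (auto simp: S_def)
      have u: "u = fwd (r - 1)" using left by (simp add: u_def)
      have dim: "?P \<in> carrier_mat (if u then 2 else 1) (if u then 1 else 2)"
        "E x \<alpha> \<in> carrier_mat (if u then 2 else 1) (if u then 1 else 2)"
        using cP cE dims(1)[of r] dims(2,4) left by (auto simp: u)
      have "?P = A \<alpha>"
        using left dims(4) A_rep \<alpha> unfolding parameter_place_def
        by (intro perturbed_other_arrow) auto
      then have "?P $$ (if u then (i, 0) else (0, i)) = (if i = 0 then 1 else 0)" if "i < 2" for i
        using left_entry[OF rq left(2) that] left(1) u by simp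
      then have "carries u (\<lambda>i j. S r x $$ (i, j)) (S (r - 1) x $$ (0, 0))
          (\<lambda>i. E x \<alpha> $$ (if u then (i, 0) else (0, i))) (\<lambda>i. ?P $$ (if u then (i, 0) else (0, i)))"
        using x left vals by (auto simp: carries_def b_def split: if_splits)
      then have "?P * (if u then S (r - 1) x else S r x) = (if u then S r x else S (r - 1) x) * E x \<alpha>"
        using carries_iff[OF dim SG] by simp
      then show ?thesis using left u by (auto split: if_splits)
    next
      case right
      have SG: "S overlap_end x \<in> carrier_mat 2 2" "S (overlap_end + 1) x \<in> carrier_mat 1 1"
        and vals: "i < 2 \<Longrightarrow> j < 2 \<Longrightarrow> S overlap_end x $$ (i, j) = G i j x" "S (overlap_end + 1) x $$ (0, 0) = s\<^sub>2 x" for i j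
        using dims(1)[of overlap_end] dims(3,4) right(2) by (auto simp: S_def)
      have w: "w = (\<not> fwd overlap_end)" using right by (simp add: w_def)
      have dim: "?P \<in> carrier_mat (if w then 2 else 1) (if w then 1 else 2)"
        "E x \<alpha> \<in> carrier_mat (if w then 2 else 1) (if w then 1 else 2)"
        using cP cE dims(1)[of overlap_end] dims(3,4) right by (auto simp: w)
      have "?P $$ (if w then (i, 0) else (0, i)) = (if i = right_summand then 1 else \<phi> x)" if "i < 2" for i
        using right_entry_perturbed[OF rq right(2) that] right(1) w by simp
      then have "carries w (\<lambda>i j. S overlap_end x $$ (i, j)) (S (overlap_end + 1) x $$ (0, 0))
          (\<lambda>i. E x \<alpha> $$ (if w then (i, 0) else (0, i))) (\<lambda>i. ?P $$ (if w then (i, 0) else (0, i)))"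
        using x right vals by (auto simp: carries_def c_def split: if_splits)
      then have "?P * (if w then S (overlap_end + 1) x else S overlap_end x) = (if w then S overlap_end x else S (overlap_end + 1) x) * E x \<alpha>"
        using carries_iff[OF dim SG] by simp
      then show ?thesis using right w by (auto split: if_splits)
    next
      case empty
      then show ?thesis
        using cP cE cS[of "head Q \<alpha>"] cS[of "tail Q \<alpha>"]
        by (intro eq_matI) (auto split: if_splits)
    next
      case flat
      have n: "n (\<alpha> + 1) = n \<alpha>" using flat by (simp add: n_def)
      have "?P = A \<alpha>"
        using flat(3) A_rep \<alpha> unfolding parameter_place_def by (intro perturbed_other_arrow) auto
      also have "\<dots> = 1\<^sub>m (n \<alpha>)" using A_flat flat \<alpha> by simp
      finally have P: "?P = 1\<^sub>m (n \<alpha>)" .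
      have "E x \<alpha> = 1\<^sub>m (n \<alpha>)" using \<open>\<And>\<alpha> x. _ \<Longrightarrow> _ \<Longrightarrow> _ \<Longrightarrow> E x \<alpha> = 1\<^sub>m (n \<alpha>)\<close> flat \<alpha> by blast
      moreover have "S (\<alpha> + 1) x = S \<alpha> x"
        using flat(4,5) n by (auto simp: S_def intro!: eq_matI)
      ultimately show ?thesis
        using P cS[of \<alpha>] by auto
    qed
  qed
  then have "intertwines Q n l S E (\<lambda>x. perturbed Q n A parameter_place (\<phi> x))"
    unfolding intertwines_def using nid by blast
  then have "intertwines Q n l (\<lambda>v x. S v x * T v x) B (\<lambda>x. perturbed Q n A parameter_place (\<phi> x))"
    by (intro intertwines_trans[OF wf_Q _ _ _ E(2)] rep_if_deformation[OF B]
        rep_if_deformation[OF E(1)] matrix_rep_perturbed)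
  then have "equivalent_deformations Q n l B (\<lambda>\<mu>. perturbed Q n A parameter_place (\<phi> \<mu>))"
    by (rule intertwines_imp_equivalent[OF fin_Q matrix_rep_perturbed])
  with \<phi> show ?thesis by blast
qed

lemma overlapping_nontrivial:
  assumes rq: "r \<le> q" and exc: exceptional_overlap
  shows "\<not> equivalent_deformations Q n 1 (\<lambda>x. perturbed Q n A parameter_place (x 0)) (\<lambda>_. A)"
proof
  let ?P = "\<lambda>x. perturbed Q n A parameter_place (x 0)"
  assume "equivalent_deformations Q n 1 ?P (\<lambda>_. A)"
  then obtain S where S: "intertwines Q n 1 S ?P (\<lambda>_. A)"
    using equivalent_imp_intertwines[OF wf_Q deformation_perturbed[OF A_rep]] by blast
  note dims = overlap_dims[OF rq]
  have pr: "p < r" and qs: "q \<noteq> s" using exc by (auto simp: exceptional_overlap_def)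
  have nid: "near_identity 1 (n v) (S v)" if "v \<in> {1..t}" for v
    using S that unfolding intertwines_def by simp
  have v: "r \<in> {1..t}" "r - 1 \<in> {1..t}" "overlap_end + 1 \<in> {1..t}" "overlap_end \<in> {1..t}"
    using dims(2)[OF pr] dims(3)[OF qs] by auto
  have diag: "\<forall>\<^sub>F x in near_zero 1. S v x $$ (i, i) \<noteq> 0" if "v \<in> {1..t}" "i < n v" for v i
    using nid[OF that(1)] that(2)
    by (intro cps_eventually_nonzero) (auto simp: near_identity_def cps_mat_def)
  have "\<forall>\<^sub>F x in near_zero 1. S r x $$ (1, 1) \<noteq> 0 \<and> S (r - 1) x $$ (0, 0) \<noteq> 0 \<and>
      S (overlap_end + 1) x $$ (0, 0) \<noteq> 0 \<and>
      (\<forall>\<alpha>\<in>arcs Q. A \<alpha> * S (tail Q \<alpha>) x = S (head Q \<alpha>) x * ?P x \<alpha>)"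
    using S v dims(1)[of r] dims(2)[OF pr] dims(3)[OF qs] dims(4)
    by (intro eventually_conj diag) (simp_all add: intertwines_def)
  then obtain x where x: "x 0 \<noteq> 0" and
    nz: "S r x $$ (1, 1) \<noteq> 0" "S (r - 1) x $$ (0, 0) \<noteq> 0" "S (overlap_end + 1) x $$ (0, 0) \<noteq> 0" and
    eqs: "\<And>\<alpha>. \<alpha> \<in> arcs Q \<Longrightarrow> A \<alpha> * S (tail Q \<alpha>) x = S (head Q \<alpha>) x * ?P x \<alpha>"
    by (rule eventually_near_zero_nonzero_witness) blast
  have cS: "S v x \<in> carrier_mat (n v) (n v)" if "v \<in> {1..t}" for v
    using near_identity_carrier[OF nid[OF that]] .
  \<comment> \<open>The identity matrices on the arrows of the overlap force one and the same basis change.\<close>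
  have const: "S v x = S r x" if "r \<le> v" "v \<le> overlap_end" for v
    using that
  proof (induction v rule: dec_induct)
    case (step v)
    then have \<alpha>: "v \<in> {1..<t}" using bounds by (auto simp: overlap_end_def)
    have "L_dim p q (v + 1) = L_dim p q v" "L_dim r s (v + 1) = L_dim r s v" "n v = 2" "n (v + 1) = 2"
      using step bounds by (auto simp: L_dim_def n_def overlap_end_def)
    then have "A v = 1\<^sub>m 2" using A_flat \<alpha> by simp
    moreover have "?P x v = A v"
      using step A_rep \<alpha> unfolding parameter_place_def by (intro perturbed_other_arrow) auto
    moreover have "S v x \<in> carrier_mat 2 2" "S (v + 1) x \<in> carrier_mat 2 2"
      using cS[of v] cS[of "v + 1"] \<alpha> \<open>n v = 2\<close> \<open>n (v + 1) = 2\<close> by auto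
    ultimately have "S (v + 1) x = S v x"
      using eqs[of v] \<alpha> by (auto split: if_splits)
    then show ?case using step by simp
  qed simp
  define u w where "u = fwd (r - 1)" and "w = (\<not> fwd overlap_end)"
  have carr: "M \<in> carrier_mat (n (head Q \<alpha>)) (n (tail Q \<alpha>))"
    if "\<alpha> \<in> {1..<t}" "M = A \<alpha> \<or> M = ?P x \<alpha>" for M \<alpha>
    using that A_rep matrix_rep_perturbed[of Q n A parameter_place "x 0"]
    by (auto simp: matrix_rep_def simp del: Q_simps(3,4))
  have G: "S r x \<in> carrier_mat 2 2" and s12: "S (r - 1) x \<in> carrier_mat 1 1" "S (overlap_end + 1) x \<in> carrier_mat 1 1"
    using cS v dims(1)[of r] dims(2)[OF pr] dims(3)[OF qs] dims(4) by force+
  have P: "?P x (r - 1) = A (r - 1)"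
    using A_rep dims(2)[OF pr] dims(4) v unfolding parameter_place_def
    by (intro perturbed_other_arrow) auto
  have l: "carries u (\<lambda>i j. S r x $$ (i, j)) (S (r - 1) x $$ (0, 0))
      (\<lambda>i. if i = 0 then 1 else 0) (\<lambda>i. if i = 0 then 1 else 0)"
  proof -
    have dim: "A (r - 1) \<in> carrier_mat (if u then 2 else 1) (if u then 1 else 2)"
      using carr[of "r - 1" "A (r - 1)"] dims(1)[of r] dims(2)[OF pr] dims(4) v by (auto simp: u_def)
    have "A (r - 1) * (if u then S (r - 1) x else S r x)
        = (if u then S r x else S (r - 1) x) * A (r - 1)"
      using eqs[of "r - 1"] dims(2)[OF pr] P v by (auto simp: u_def)
    then have "carries u (\<lambda>i j. S r x $$ (i, j)) (S (r - 1) x $$ (0, 0))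
        (\<lambda>i. A (r - 1) $$ (if u then (i, 0) else (0, i)))
        (\<lambda>i. A (r - 1) $$ (if u then (i, 0) else (0, i)))"
      using carries_iff[OF dim dim G s12(1)] by blast
    then show ?thesis
      by (rule carries_cong[THEN iffD1, rotated -1])
        (use left_entry[OF rq pr] in \<open>simp_all add: u_def\<close>)
  qed
  have r: "carries w (\<lambda>i j. S r x $$ (i, j)) (S (overlap_end + 1) x $$ (0, 0))
      (\<lambda>i. if i = right_summand then 1 else x 0) (\<lambda>i. if i = right_summand then 1 else 0)"
  proof -
    have dim: "A overlap_end \<in> carrier_mat (if w then 2 else 1) (if w then 1 else 2)"
      "?P x overlap_end \<in> carrier_mat (if w then 2 else 1) (if w then 1 else 2)"
      using carr[of overlap_end "A overlap_end"] carr[of overlap_end "?P x overlap_end"] dims(1)[of overlap_end] dims(3)[OF qs] dims(4)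
      by (auto simp: w_def)
    have "A overlap_end * (if w then S (overlap_end + 1) x else S r x) = (if w then S r x else S (overlap_end + 1) x) * ?P x overlap_end"
      using eqs[of overlap_end] dims(3)[OF qs] const[of overlap_end] dims(4) by (auto simp: w_def)
    then have "carries w (\<lambda>i j. S r x $$ (i, j)) (S (overlap_end + 1) x $$ (0, 0))
        (\<lambda>i. ?P x overlap_end $$ (if w then (i, 0) else (0, i))) (\<lambda>i. A overlap_end $$ (if w then (i, 0) else (0, i)))"
      using carries_iff[OF dim G s12(2)] by blast
    then show ?thesis
      by (rule carries_cong[THEN iffD1, rotated -1])
        (use right_entry[OF rq qs] right_entry_perturbed[OF rq qs] in \<open>simp_all add: w_def\<close>)
  qed
  have "x 0 = 0"
    by (rule plane_parameter_invariant[OF l r])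
      (use exc nz in \<open>auto simp: exceptional_overlap_def u_def w_def right_summand_def\<close>)
  with x show False ..
qed

subsection \<open>The deformations in matrix form\<close>

lemma exceptional_overlap_iff:
  assumes "r \<le> q"
  shows "exceptional_overlap \<longleftrightarrow> overlap_right fwd p q r s \<or> overlap_left fwd p q r s \<or>
    nested_inward fwd p q r s \<or> nested_outward fwd p q r s"
proof (cases "q < s")
  case True
  then have "right_summand = 1" "overlap_end = q" by (auto simp: right_summand_def overlap_end_def)
  then show ?thesis
    using True assms by (auto simp: exceptional_overlap_def overlap_right_def overlap_left_def
        nested_inward_def nested_outward_def)
next
  case False
  then have "right_summand = 0" "overlap_end = s" by (auto simp: right_summand_def overlap_end_def)
  then show ?thesis
    using False assms bounds by (auto simp: exceptional_overlap_def overlap_right_def overlap_left_def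
        nested_inward_def nested_outward_def)
qed

lemma rigid:
  assumes "\<not> adjacent_pair p q r s" "\<not> (r \<le> q \<and> exceptional_overlap)"
    and B: "deformation Q n l A B"
  shows "equivalent_deformations Q n l B (\<lambda>_. A)"
proof -
  have "\<exists>\<gamma>. equivalent_deformations Q n l B (\<lambda>\<mu>. perturbed Q n A \<gamma> 0)"
  proof (cases "r \<le> q")
    case True
    then show ?thesis
      using reduce_overlapping[OF True B] assms(2) by (intro exI[of _ parameter_place]) auto
  next
    case False
    then show ?thesis
      using reduce_disjoint[OF _ B] assms(1) by (intro exI[of _ "(q, 0, 0)"]) auto
  qed
  then obtain \<gamma> where "equivalent_deformations Q n l B (\<lambda>\<mu>. perturbed Q n A \<gamma> 0)" ..
  then show ?thesis
    using perturbed_0[OF A_rep]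
    by (subst equivalent_deformations_cong[where D' = B and E' = "\<lambda>_. perturbed Q n A \<gamma> 0"]) auto
qed

lemma adjacent_simplest_miniversal:
  assumes adj: "adjacent_pair p q r s"
  shows "simplest_miniversal Q n 1 A
    (\<lambda>x \<alpha>. if \<alpha> = q then mat_of_rows_list 1 [[x 0]] else A \<alpha>)"
proof (rule simplest_miniversal_1[OF A_rep refl _ _ _ _ adjacent_nontrivial[OF adj]])
  have q: "q < r" "q \<in> {1..<t}" "n q = 1" "n (q + 1) = 1"
    using adj bounds by (auto simp: adjacent_pair_def n_def L_dim_def)
  then show "q \<in> arcs Q" "0 < n (head Q q)" "0 < n (tail Q q)" by auto
  show "\<exists>\<phi>. convergent_power_series l \<phi> \<and> \<phi> (\<lambda>_. 0) = 0 \<and>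
      equivalent_deformations Q n l B (\<lambda>\<mu>. perturbed Q n A (q, 0, 0) (\<phi> \<mu>))"
    if "deformation Q n l A B" for l B
    using reduce_disjoint[OF q(1) that] by blast
  have "A q $$ (0, 0) = 0"
    using q adj bounds by (subst A_entry) (auto simp: L_dim_def adjacent_pair_def)
  then have "perturbed Q n A (q, 0, 0) a q = mat_of_rows_list 1 [[a]]" for a
    using q by (subst mat_of_rows_list_small(1)) (auto simp: perturbed_def)
  then show "(if \<alpha> = q then mat_of_rows_list 1 [[x 0]] else A \<alpha>)
      = perturbed Q n A (q, 0, 0) (x 0) \<alpha>" if "\<alpha> \<in> arcs Q" for x :: "nat \<Rightarrow> 'a" and \<alpha>
    using perturbed_other_arrow[OF A_rep that, of q] by (cases "\<alpha> = q") simp_all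
qed

lemma overlapping_simplest_miniversal:
  assumes rq: "r \<le> q" and exc: exceptional_overlap
    and D: "\<And>x \<alpha>. \<alpha> \<in> arcs Q \<Longrightarrow> D x \<alpha> = perturbed Q n A parameter_place (x 0) \<alpha>"
  shows "simplest_miniversal Q n 1 A D"
proof (rule simplest_miniversal_1[where \<gamma> = parameter_place and \<beta> = overlap_end
      and i = "fst (if fwd overlap_end then (0, 1 - right_summand) else (1 - right_summand, 0))"
      and j = "snd (if fwd overlap_end then (0, 1 - right_summand) else (1 - right_summand, 0))",
      OF A_rep _ _ _ _ _ overlapping_nontrivial[OF rq exc]])
  show "parameter_place = (overlap_end, fst (if fwd overlap_end then (0, 1 - right_summand) else (1 - right_summand, 0)),
      snd (if fwd overlap_end then (0, 1 - right_summand) else (1 - right_summand, 0)))"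
    by (simp add: parameter_place_def)
  have qs: "q \<noteq> s" using exc by (simp add: exceptional_overlap_def)
  note dims = overlap_dims(1)[OF rq, of overlap_end] overlap_dims(3)[OF rq qs] overlap_dims(4)[OF rq]
  show "overlap_end \<in> arcs Q" using dims by simp
  show "fst (if fwd overlap_end then (0, 1 - right_summand) else (1 - right_summand, 0)) < n (head Q overlap_end)"
    "snd (if fwd overlap_end then (0, 1 - right_summand) else (1 - right_summand, 0)) < n (tail Q overlap_end)"
    using dims by auto
  show "\<exists>\<phi>. convergent_power_series l \<phi> \<and> \<phi> (\<lambda>_. 0) = 0 \<and>
      equivalent_deformations Q n l B (\<lambda>\<mu>. perturbed Q n A parameter_place (\<phi> \<mu>))"
    if "deformation Q n l A B" for l B
    using reduce_overlapping[OF rq that] by blast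
qed (rule D)

lemma left_matrix:
  assumes "r \<le> q" "p < r"
  shows "A (r - 1) = (if fwd (r - 1) then mat_of_rows_list 1 [[1], [0]] else mat_of_rows_list 2 [[1, 0]])"
proof -
  note dims = overlap_dims(1)[OF assms(1), of r] overlap_dims(2)[OF assms] overlap_dims(4)[OF assms(1)]
  show ?thesis
  proof (cases "fwd (r - 1)")
    case True
    then have "A (r - 1) \<in> carrier_mat 2 1"
      using A_carrier[of "r - 1"] dims by auto
    from mat_of_rows_list_small(2)[OF this] show ?thesis
      using left_entry[OF assms, of 0] left_entry[OF assms, of 1] True by simp
  next
    case False
    then have "A (r - 1) \<in> carrier_mat 1 2"
      using A_carrier[of "r - 1"] dims by auto
    from mat_of_rows_list_small(3)[OF this] show ?thesis
      using left_entry[OF assms, of 0] left_entry[OF assms, of 1] False by simp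
  qed
qed

lemma right_matrix:
  assumes "r \<le> q" "q \<noteq> s"
  shows "perturbed Q n A parameter_place a overlap_end =
    (if fwd overlap_end then mat_of_rows_list 2 [if right_summand = 0 then [1, a] else [a, 1]]
     else mat_of_rows_list 1 (if right_summand = 0 then [[1], [a]] else [[a], [1]]))"
proof -
  note dims = overlap_dims(1)[OF assms(1), of overlap_end] overlap_dims(3)[OF assms] overlap_dims(4)[OF assms(1)]
  have c: "perturbed Q n A parameter_place a overlap_end \<in> carrier_mat (n (head Q overlap_end)) (n (tail Q overlap_end))"
    by (simp add: perturbed_def)
  note entry = right_entry_perturbed[OF assms, of 0] right_entry_perturbed[OF assms, of 1]
  have right_summand: "right_summand = 0 \<or> right_summand = 1" by (simp add: right_summand_def)
  show ?thesis
  proof (cases "fwd overlap_end")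
    case True
    then have "perturbed Q n A parameter_place a overlap_end \<in> carrier_mat 1 2"
      using c dims by auto
    from mat_of_rows_list_small(3)[OF this] show ?thesis
      using entry right_summand True by auto
  next
    case False
    then have "perturbed Q n A parameter_place a overlap_end \<in> carrier_mat 2 1"
      using c dims by auto
    from mat_of_rows_list_small(2)[OF this] show ?thesis
      using entry right_summand False by auto
  qed
qed

lemma overlap_matrices:
  assumes rq: "r \<le> q" "p < r" "q \<noteq> s" and \<alpha>: "\<alpha> \<in> arcs Q"
  shows "perturbed Q n A parameter_place a \<alpha> =
    (if \<alpha> = r - 1 then
       if fwd (r - 1) then mat_of_rows_list 1 [[1], [0]] else mat_of_rows_list 2 [[1, 0]]
     else if r \<le> \<alpha> \<and> \<alpha> < overlap_end then 1\<^sub>m 2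
     else if \<alpha> = overlap_end then
       if fwd overlap_end then mat_of_rows_list 2 [if right_summand = 0 then [1, a] else [a, 1]]
       else mat_of_rows_list 1 (if right_summand = 0 then [[1], [a]] else [[a], [1]])
     else A \<alpha>)"
proof (cases "\<alpha> = overlap_end")
  case True
  then show ?thesis
    using right_matrix[OF rq(1,3)] overlap_dims(4)[OF rq(1)] bounds rq by auto
next
  case False
  then have P: "perturbed Q n A parameter_place a \<alpha> = A \<alpha>"
    unfolding parameter_place_def by (intro perturbed_other_arrow A_rep \<alpha>)
  have "A \<alpha> = 1\<^sub>m 2" if "r \<le> \<alpha>" "\<alpha> < overlap_end"
    using that A_flat[of \<alpha>] \<alpha> overlap_dims(1)[OF rq(1), of \<alpha>] bounds
    by (auto simp: overlap_end_def L_dim_def)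
  with P False show ?thesis
    using left_matrix[OF rq(1,2)] by auto
qed

end

theorem theorem6:
  fixes fwd :: "nat \<Rightarrow> bool" and t p q r s :: nat
    and Q :: "(nat, nat) pre_digraph" and n :: "nat \<Rightarrow> nat"
    and A :: "nat \<Rightarrow> 'a::{real_normed_field,banach} mat"
  assumes "1 \<le> t"
    and "1 \<le> p" and "p \<le> q" and "q \<le> t"
    and "1 \<le> r" and "r \<le> s" and "s \<le> t"
    and "p \<le> r"
    and "Q = chain_quiver t fwd"
    and "n = (\<lambda>v. L_dim p q v + L_dim r s v)"
    and "A = rep_sum (L_rep Q p q) (L_rep Q r s)"
  shows
    "(\<forall>k D. miniversal Q n k A D \<longrightarrow> k \<le> 1) \<and>
     (\<not> adjacent_pair p q r s \<and>
      \<not> overlap_right fwd p q r s \<and> \<not> overlap_left fwd p q r s \<and>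
      \<not> nested_inward fwd p q r s \<and> \<not> nested_outward fwd p q r s \<longrightarrow>
       simplest_miniversal Q n 0 A (\<lambda>x. A) \<and>
       (\<forall>k D. miniversal Q n k A D \<longrightarrow> k = 0 \<and> (\<forall>x. \<forall>\<alpha>\<in>arcs Q. D x \<alpha> = A \<alpha>))) \<and>
     (adjacent_pair p q r s \<longrightarrow>
       simplest_miniversal Q n 1 A (\<lambda>x \<alpha>.
         if \<alpha> = q then mat_of_rows_list 1 [[x 0]]
         else A \<alpha>)) \<and>
     (overlap_right fwd p q r s \<longrightarrow>
       simplest_miniversal Q n 1 A (\<lambda>x \<alpha>.
         if \<alpha> = r - 1 then mat_of_rows_list 1 [[1], [0]]
         else if r \<le> \<alpha> \<and> \<alpha> < q then 1\<^sub>m 2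
         else if \<alpha> = q then mat_of_rows_list 2 [[x 0, 1]]
         else A \<alpha>)) \<and>
     (overlap_left fwd p q r s \<longrightarrow>
       simplest_miniversal Q n 1 A (\<lambda>x \<alpha>.
         if \<alpha> = r - 1 then mat_of_rows_list 2 [[1, 0]]
         else if r \<le> \<alpha> \<and> \<alpha> < q then 1\<^sub>m 2
         else if \<alpha> = q then mat_of_rows_list 1 [[x 0], [1]]
         else A \<alpha>)) \<and>
     (nested_inward fwd p q r s \<longrightarrow>
       simplest_miniversal Q n 1 A (\<lambda>x \<alpha>.
         if \<alpha> = r - 1 then mat_of_rows_list 1 [[1], [0]]
         else if r \<le> \<alpha> \<and> \<alpha> < s then 1\<^sub>m 2
         else if \<alpha> = s then mat_of_rows_list 1 [[1], [x 0]]
         else A \<alpha>)) \<and>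
     (nested_outward fwd p q r s \<longrightarrow>
       simplest_miniversal Q n 1 A (\<lambda>x \<alpha>.
         if \<alpha> = r - 1 then mat_of_rows_list 2 [[1, 0]]
         else if r \<le> \<alpha> \<and> \<alpha> < s then 1\<^sub>m 2
         else if \<alpha> = s then mat_of_rows_list 2 [[1, x 0]]
         else A \<alpha>))"
proof -
  interpret interval_pair fwd t p q r s Q n A
    by unfold_locales (use assms in auto)
  have overlap: "simplest_miniversal Q n 1 A D"
    if rq: "r \<le> q" and exc: exceptional_overlap and D:
      "\<And>x \<alpha>. \<alpha> \<in> arcs Q \<Longrightarrow> D x \<alpha> =
        (if \<alpha> = r - 1 then
           if fwd (r - 1) then mat_of_rows_list 1 [[1], [0]] else mat_of_rows_list 2 [[1, 0]]
         else if r \<le> \<alpha> \<and> \<alpha> < overlap_end then 1\<^sub>m 2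
         else if \<alpha> = overlap_end then
           if fwd overlap_end then mat_of_rows_list 2 [if right_summand = 0 then [1, x 0] else [x 0, 1]]
           else mat_of_rows_list 1 (if right_summand = 0 then [[1], [x 0]] else [[x 0], [1]])
         else A \<alpha>)" for D
  proof (rule overlapping_simplest_miniversal[OF rq exc])
    have "p < r" "q \<noteq> s" using exc by (auto simp: exceptional_overlap_def)
    then show "D x \<alpha> = perturbed Q n A parameter_place (x 0) \<alpha>" if "\<alpha> \<in> arcs Q" for x \<alpha>
      using overlap_matrices[OF rq _ _ that] D[OF that] by metis
  qed
  have proper: "right_summand = 1" "overlap_end = q" if "q < s" using that by (auto simp: right_summand_def overlap_end_def)
  have nested: "right_summand = 0" "overlap_end = s" if "s < q" using that by (auto simp: right_summand_def overlap_end_def)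
  have right: "simplest_miniversal Q n 1 A (\<lambda>x \<alpha>.
         if \<alpha> = r - 1 then mat_of_rows_list 1 [[1], [0]]
         else if r \<le> \<alpha> \<and> \<alpha> < q then 1\<^sub>m 2
         else if \<alpha> = q then mat_of_rows_list 2 [[x 0, 1]]
         else A \<alpha>)" if "overlap_right fwd p q r s"
    using that proper exceptional_overlap_iff by (intro overlap) (auto simp: overlap_right_def)
  have left: "simplest_miniversal Q n 1 A (\<lambda>x \<alpha>.
         if \<alpha> = r - 1 then mat_of_rows_list 2 [[1, 0]]
         else if r \<le> \<alpha> \<and> \<alpha> < q then 1\<^sub>m 2
         else if \<alpha> = q then mat_of_rows_list 1 [[x 0], [1]]
         else A \<alpha>)" if "overlap_left fwd p q r s"
    using that proper exceptional_overlap_iff by (intro overlap) (auto simp: overlap_left_def)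
  have inward: "simplest_miniversal Q n 1 A (\<lambda>x \<alpha>.
         if \<alpha> = r - 1 then mat_of_rows_list 1 [[1], [0]]
         else if r \<le> \<alpha> \<and> \<alpha> < s then 1\<^sub>m 2
         else if \<alpha> = s then mat_of_rows_list 1 [[1], [x 0]]
         else A \<alpha>)" if "nested_inward fwd p q r s"
    using that nested exceptional_overlap_iff by (intro overlap) (auto simp: nested_inward_def)
  have outward: "simplest_miniversal Q n 1 A (\<lambda>x \<alpha>.
         if \<alpha> = r - 1 then mat_of_rows_list 2 [[1, 0]]
         else if r \<le> \<alpha> \<and> \<alpha> < s then 1\<^sub>m 2
         else if \<alpha> = s then mat_of_rows_list 2 [[1, x 0]]
         else A \<alpha>)" if "nested_outward fwd p q r s"
    using that nested exceptional_overlap_iff by (intro overlap) (auto simp: nested_outward_def)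
  have rigid: "simplest_miniversal Q n 0 A (\<lambda>_. A)"
    "\<And>k D. miniversal Q n k A D \<Longrightarrow> k = 0 \<and> (\<forall>x. \<forall>\<alpha>\<in>arcs Q. D x \<alpha> = A \<alpha>)"
    if "\<not> adjacent_pair p q r s \<and>
      \<not> overlap_right fwd p q r s \<and> \<not> overlap_left fwd p q r s \<and>
      \<not> nested_inward fwd p q r s \<and> \<not> nested_outward fwd p q r s"
    using simplest_miniversal_0[OF A_rep rigid] that exceptional_overlap_iff by blast+
  have "\<exists>k\<le>1. \<exists>D. simplest_miniversal Q n k A D"
    using right left inward outward rigid(1) adjacent_simplest_miniversal
    by (meson le_numeral_extra(4) zero_le_one)
  then have "k \<le> 1" if "miniversal Q n k A D" for k D
    using that unfolding simplest_miniversal_def miniversal_def by (meson order_trans)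
  then show ?thesis
    using right left inward outward rigid adjacent_simplest_miniversal by blast
qed

end
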